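(* Let $\Omega$ be a bounded, open, convex subset of $\mathbb R^d$, let $\mathsf m:[0,+\infty)\to[0,+\infty)$ be a mobility function (so $M=+\infty$), and let $\mathfrak m>0$. If the measures $\mu_i=\rho_i\mathscr L^d|_\Omega\in\mathcal M^+(\Omega,\mathfrak m)$, $i=0,1$, satisfy $$\int_\Omega\frac{\rho_i(x)^2}{\mathsf m(\rho_i(x))}\,dx<+\infty,\qquad i=0,1,$$ then $\mathcal W_{\mathsf m,\Omega}(\mu_0,\mu_1)<+\infty$.
   Context: **Mobility.** $\mathsf m:[0,+\infty)\to[0,+\infty)$ is continuous, concave, strictly positive in $(0,+\infty)$; $\mathsf m'(\infty):=\lim_{r\to+\infty}\mathsf m(r)/r\ge0$. Conventions: $a/b=0$ if $a=b=0$, $a/b=+\infty$ if $a>0=b$. Action density: $\phi_{\mathsf m}(\rho,w)=|w|^2/\mathsf m(\rho)$ if $\rho\ge0$, $+\infty$ otherwise ($w\in\mathbb R^d$). **Measures and continuity equation.** $\mathcal M^+(B)$: finite positive Borel measures on $\mathbb R^d$ concentrated on the Borel set $B$; $\mathcal M^+(B,\mathfrak m)$: those with total mass $\mathfrak m$; $\mathcal M(\overline\Omega;\mathbb R^d)$: $\mathbb R^d$-valued Borel measures of finite total variation concentrated on $\overline\Omega$. $\mathcal{CE}_\Omega(\mu_0\to\mu_1)$ is the set of pairs $(\mu_s)_{s\in[0,1]}\subset\mathcal M^+(\overline\Omega)$, $(\nu_s)_{s\in(0,1)}\subset\mathcal M(\overline\Omega;\mathbb R^d)$ such that $s\mapsto\mu_s$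 is weakly$^*$ continuous with values $\mu_0,\mu_1$ at $s=0,1$; $(\nu_s)$ is a Borel family with $\int_0^1|\nu_s|(\overline\Omega)\,ds<+\infty$; and $\partial_s\mu_s+\nabla\cdot\nu_s=0$ in distributions in $(0,1)\times\mathbb R^d$. **Action and distance.** With Lebesgue decompositions $\mu=\rho\mathscr L^d+\mu^\perp$, $\nu=w\mathscr L^d+\nu^\perp$: $\Phi_{\mathsf m,\Omega}(\mu,\nu)=+\infty$ if $\mu$ or $\nu$ is not supported in $\overline\Omega$; otherwise, if $\mathsf m'(\infty)=0$, it equals $\int_\Omega\phi_{\mathsf m}(\rho,w)\,dx$ if $\nu^\perp=0$ and $+\infty$ otherwise; if $\mathsf m'(\infty)>0$, it equals $\int_\Omega\phi_{\mathsf m}(\rho,w)\,dx+\int_{\overline\Omega}|w^\perp|^2/\mathsf m'(\infty)\,d\mu^\perp$ if $\nu^\perp=w^\perp\mu^\perp\ll\mu^\perp$ and $+\infty$ otherwise. $\mathcal W_{\mathsf m,\Omega}^2(\mu_0,\mu_1):=\inf\{\int_0^1\Phi_{\mathsf m,\Omega}(\mu_s,\nu_s)\,ds:(\mu,\nu)\in\mathcal{CE}_\Omega(\mu_0\to\mu_1)\}$ ($+\infty$ if the set is empty). *)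

theory Defs
  imports "HOL-Analysis.Analysis"
begin

text \<open>Only the values of a mobility on \<open>{0..}\<close> are relevant; the Euclidean space
  \<open>'a\<close> plays the role of \<open>R^d\<close>.\<close>

definition mobility :: "(real \<Rightarrow> real) \<Rightarrow> bool" where
  "mobility m \<longleftrightarrow> continuous_on {0..} m \<and> concave_on {0..} m \<and>
     (\<forall>r\<ge>0. 0 \<le> m r) \<and> (\<forall>r>0. 0 < m r)"

definition mob_slope :: "(real \<Rightarrow> real) \<Rightarrow> real" where
  "mob_slope m = Lim at_top (\<lambda>r. m r / r)"

text \<open>Division on \<^typ>\<open>ennreal\<close> satisfies \<open>0 / 0 = 0\<close> and \<open>a / 0 = \<infinity>\<close> for \<open>a > 0\<close>.\<close>

definition action_density :: "(real \<Rightarrow> real) \<Rightarrow> real \<Rightarrow> 'a::euclidean_space \<Rightarrow> ennreal" where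
  "action_density m r w =
     (if 0 \<le> r then ennreal ((norm w)\<^sup>2) / ennreal (m r) else \<infinity>)"

definition pos_measures :: "'a::euclidean_space set \<Rightarrow> 'a measure set" where
  "pos_measures B = {\<mu>. sets \<mu> = sets borel \<and> finite_measure \<mu> \<and> emeasure \<mu> (- B) = 0}"

definition pos_measures_mass :: "'a::euclidean_space set \<Rightarrow> real \<Rightarrow> 'a measure set" where
  "pos_measures_mass B c = {\<mu> \<in> pos_measures B. emeasure \<mu> UNIV = ennreal c}"

text \<open>An \<open>R^d\<close>-valued Borel measure is a countably additive set function on the Borel sets;
  as for \<^typ>\<open>'a measure\<close>, it is set to \<open>0\<close> off the Borel sets, so that vector measures are
  equal iff they agree on Borel sets.\<close>

definition total_variation :: "('a::euclidean_space set \<Rightarrow> 'a) \<Rightarrow> 'a set \<Rightarrow> ennreal" where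
  "total_variation \<nu> A =
     (SUP P \<in> {P. finite P \<and> P \<subseteq> sets borel \<and> disjoint P \<and> \<Union>P = A}.
        \<Sum>B\<in>P. ennreal (norm (\<nu> B)))"

definition vector_measure :: "('a::euclidean_space set \<Rightarrow> 'a) \<Rightarrow> bool" where
  "vector_measure \<nu> \<longleftrightarrow>
     (\<forall>A. A \<notin> sets borel \<longrightarrow> \<nu> A = 0) \<and>
     (\<forall>A :: nat \<Rightarrow> 'a set. range A \<subseteq> sets borel \<longrightarrow> disjoint_family A \<longrightarrow>
        (\<lambda>i. \<nu> (A i)) sums \<nu> (\<Union>i. A i)) \<and>
     total_variation \<nu> UNIV < \<infinity>"

definition vector_measures :: "'a::euclidean_space set \<Rightarrow> ('a set \<Rightarrow> 'a) set" where
  "vector_measures B = {\<nu>. vector_measure \<nu> \<and> total_variation \<nu> (- B) = 0}"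

text \<open>The positive part, in the Hahn--Jordan decomposition, of the signed measure
  \<open>A \<mapsto> \<nu> A \<bullet> b\<close>; its negative part is \<open>pos_part \<nu> (- b)\<close>. The embedding
  \<^const>\<open>ennreal\<close> truncates negative values, which is harmless as \<open>B = {}\<close> contributes \<open>0\<close>.\<close>

definition pos_part :: "('a::euclidean_space set \<Rightarrow> 'a) \<Rightarrow> 'a \<Rightarrow> 'a measure" where
  "pos_part \<nu> b = measure_of UNIV (sets borel)
     (\<lambda>A. SUP B \<in> {B \<in> sets borel. B \<subseteq> A}. ennreal (\<nu> B \<bullet> b))"

text \<open>The integral of a vector field \<open>F\<close> against \<open>\<nu>\<close>, that is the sum over the coordinates of
  the integrals of \<open>F \<bullet> b\<close> against the signed measures \<open>A \<mapsto> \<nu> A \<bullet> b\<close>.\<close>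

definition vector_integral ::
    "('a::euclidean_space set \<Rightarrow> 'a) \<Rightarrow> ('a \<Rightarrow> 'a) \<Rightarrow> real" where
  "vector_integral \<nu> F =
     (\<Sum>b\<in>Basis. (\<integral>x. F x \<bullet> b \<partial>pos_part \<nu> b) - (\<integral>x. F x \<bullet> b \<partial>pos_part \<nu> (- b)))"

text \<open>In finite dimension, \<open>C^k\<close> may be tested on directional derivatives.\<close>

primrec C_k :: "nat \<Rightarrow> ('b::real_normed_vector \<Rightarrow> real) \<Rightarrow> bool" where
  "C_k 0 f \<longleftrightarrow> continuous_on UNIV f"
| "C_k (Suc k) f \<longleftrightarrow> (\<forall>x. f differentiable (at x)) \<and>
     (\<forall>v. C_k k (\<lambda>x. frechet_derivative f (at x) v))"

definition test_function :: "(real \<times> 'a::euclidean_space \<Rightarrow> real) \<Rightarrow> bool" where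
  "test_function \<phi> \<longleftrightarrow> (\<forall>k. C_k k \<phi>) \<and> compact (closure {z. \<phi> z \<noteq> 0}) \<and>
     closure {z. \<phi> z \<noteq> 0} \<subseteq> {0<..<1} \<times> UNIV"

definition time_deriv :: "(real \<times> 'a::euclidean_space \<Rightarrow> real) \<Rightarrow> real \<Rightarrow> 'a \<Rightarrow> real" where
  "time_deriv \<phi> s x = frechet_derivative \<phi> (at (s, x)) (1, 0)"

definition space_grad :: "(real \<times> 'a::euclidean_space \<Rightarrow> real) \<Rightarrow> real \<Rightarrow> 'a \<Rightarrow> 'a" where
  "space_grad \<phi> s x = (\<Sum>b\<in>Basis. frechet_derivative \<phi> (at (s, x)) (0, b) *\<^sub>R b)"

definition weak_star_continuous :: "(real \<Rightarrow> 'a::euclidean_space measure) \<Rightarrow> bool" where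
  "weak_star_continuous \<mu> \<longleftrightarrow>
     (\<forall>f :: 'a \<Rightarrow> real. continuous_on UNIV f \<longrightarrow> compact (closure {x. f x \<noteq> 0}) \<longrightarrow>
        continuous_on {0..1} (\<lambda>s. \<integral>x. f x \<partial>\<mu> s))"

text \<open>\<open>CE \<Omega> \<mu>0 \<mu>1\<close>: the curves are functions on all of \<^typ>\<open>real\<close>, of which only the values
  of \<open>\<mu>\<close> on \<open>{0..1}\<close> and those of \<open>\<nu>\<close> on \<open>{0<..<1}\<close> matter.\<close>

definition CE :: "'a::euclidean_space set \<Rightarrow> 'a measure \<Rightarrow> 'a measure \<Rightarrow>
    ((real \<Rightarrow> 'a measure) \<times> (real \<Rightarrow> 'a set \<Rightarrow> 'a)) set" where
  "CE \<Omega> \<mu>0 \<mu>1 = {(\<mu>, \<nu>).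
     (\<forall>s\<in>{0..1}. \<mu> s \<in> pos_measures (closure \<Omega>)) \<and>
     (\<forall>s\<in>{0<..<1}. \<nu> s \<in> vector_measures (closure \<Omega>)) \<and>
     weak_star_continuous \<mu> \<and> \<mu> 0 = \<mu>0 \<and> \<mu> 1 = \<mu>1 \<and>
     (\<forall>B\<in>sets borel. (\<lambda>s. \<nu> s B) \<in> borel_measurable (restrict_space borel {0<..<1})) \<and>
     (\<integral>\<^sup>+s\<in>{0<..<1}. total_variation (\<nu> s) (closure \<Omega>) \<partial>lborel) < \<infinity> \<and>
     (\<forall>\<phi>. test_function \<phi> \<longrightarrow>
        (LINT s:{0<..<1}|lborel. (\<integral>x. time_deriv \<phi> s x \<partial>\<mu> s)) +
        (LINT s:{0<..<1}|lborel. vector_integral (\<nu> s) (space_grad \<phi> s)) = 0)}"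

definition lebesgue_decomp ::
    "'a::euclidean_space measure \<Rightarrow> ('a \<Rightarrow> real) \<Rightarrow> 'a measure \<Rightarrow> bool" where
  "lebesgue_decomp \<mu> \<rho> \<mu>s \<longleftrightarrow>
     integrable lborel \<rho> \<and> (\<forall>x. 0 \<le> \<rho> x) \<and> \<mu>s \<in> pos_measures UNIV \<and>
     (\<exists>N\<in>null_sets lborel. emeasure \<mu>s (- N) = 0) \<and>
     (\<forall>A\<in>sets borel. emeasure \<mu> A = (\<integral>\<^sup>+x\<in>A. ennreal (\<rho> x) \<partial>lborel) + emeasure \<mu>s A)"

definition ac_dens :: "'a::euclidean_space measure \<Rightarrow> 'a \<Rightarrow> real" where
  "ac_dens \<mu> = (SOME \<rho>. \<exists>\<mu>s. lebesgue_decomp \<mu> \<rho> \<mu>s)"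

definition sing_part :: "'a::euclidean_space measure \<Rightarrow> 'a measure" where
  "sing_part \<mu> = (THE \<mu>s. \<exists>\<rho>. lebesgue_decomp \<mu> \<rho> \<mu>s)"

definition vec_lebesgue_decomp ::
    "('a::euclidean_space set \<Rightarrow> 'a) \<Rightarrow> ('a \<Rightarrow> 'a) \<Rightarrow> ('a set \<Rightarrow> 'a) \<Rightarrow> bool" where
  "vec_lebesgue_decomp \<nu> w \<nu>s \<longleftrightarrow>
     integrable lborel w \<and> vector_measure \<nu>s \<and>
     (\<exists>N\<in>null_sets lborel. total_variation \<nu>s (- N) = 0) \<and>
     (\<forall>A\<in>sets borel. \<nu> A = (LINT x:A|lborel. w x) + \<nu>s A)"

definition vec_ac_dens :: "('a::euclidean_space set \<Rightarrow> 'a) \<Rightarrow> 'a \<Rightarrow> 'a" where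
  "vec_ac_dens \<nu> = (SOME w. \<exists>\<nu>s. vec_lebesgue_decomp \<nu> w \<nu>s)"

definition vec_sing_part :: "('a::euclidean_space set \<Rightarrow> 'a) \<Rightarrow> 'a set \<Rightarrow> 'a" where
  "vec_sing_part \<nu> = (THE \<nu>s. \<exists>w. vec_lebesgue_decomp \<nu> w \<nu>s)"

definition vec_density :: "('a::euclidean_space set \<Rightarrow> 'a) \<Rightarrow> 'a measure \<Rightarrow> ('a \<Rightarrow> 'a) \<Rightarrow> bool" where
  "vec_density \<nu> \<mu> w \<longleftrightarrow>
     integrable \<mu> w \<and> (\<forall>A\<in>sets borel. \<nu> A = (LINT x:A|\<mu>. w x))"

text \<open>The densities are determined up to null sets, so the choices of representatives
  made here do not affect the value.\<close>

definition action :: "(real \<Rightarrow> real) \<Rightarrow> 'a::euclidean_space set \<Rightarrow> 'a measure \<Rightarrow>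
    ('a set \<Rightarrow> 'a) \<Rightarrow> ennreal" where
  "action m \<Omega> \<mu> \<nu> =
     (if emeasure \<mu> (- closure \<Omega>) \<noteq> 0 \<or> total_variation \<nu> (- closure \<Omega>) \<noteq> 0 then \<infinity>
      else let ac = (\<integral>\<^sup>+x\<in>\<Omega>. action_density m (ac_dens \<mu> x) (vec_ac_dens \<nu> x) \<partial>lborel);
               \<mu>s = sing_part \<mu>; \<nu>s = vec_sing_part \<nu>
      in if mob_slope m = 0 then (if \<nu>s = (\<lambda>A. 0) then ac else \<infinity>)
         else if \<exists>w. vec_density \<nu>s \<mu>s w
              then ac + (\<integral>\<^sup>+x\<in>closure \<Omega>.
                     ennreal ((norm ((SOME w. vec_density \<nu>s \<mu>s w) x))\<^sup>2)
                       / ennreal (mob_slope m) \<partial>\<mu>s)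
              else \<infinity>)"

definition mob_dist_sq :: "(real \<Rightarrow> real) \<Rightarrow> 'a::euclidean_space set \<Rightarrow> 'a measure \<Rightarrow>
    'a measure \<Rightarrow> ennreal" where
  "mob_dist_sq m \<Omega> \<mu>0 \<mu>1 =
     (INF (\<mu>, \<nu>) \<in> CE \<Omega> \<mu>0 \<mu>1. \<integral>\<^sup>+s\<in>{0<..<1}. action m \<Omega> (\<mu> s) (\<nu> s) \<partial>lborel)"

definition mob_dist :: "(real \<Rightarrow> real) \<Rightarrow> 'a::euclidean_space set \<Rightarrow> 'a measure \<Rightarrow>
    'a measure \<Rightarrow> ennreal" where
  "mob_dist m \<Omega> \<mu>0 \<mu>1 =
     (if mob_dist_sq m \<Omega> \<mu>0 \<mu>1 = \<infinity> then \<infinity>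
      else ennreal (sqrt (enn2real (mob_dist_sq m \<Omega> \<mu>0 \<mu>1))))"

end

theory Submission
  imports Defs "HOL-Probability.Probability_Measure"
begin

text \<open>Normalise the product measure \<open>\<mu>0 \<Otimes> \<mu>1\<close> to the coupling \<open>\<pi>\<close> of mass \<open>c\<close>, and let mass
  travel along the straight segments \<open>T s (x, y) = (1 - s) x + s y\<close>: take for \<open>\<mu> s\<close> the image of
  \<open>\<pi>\<close> under \<open>T s\<close> and for \<open>\<nu> s\<close> the image of \<open>(y - x) \<pi>\<close>. No optimality of the coupling is
  needed: since \<open>\<Omega>\<close> is bounded, \<open>\<nu> s\<close> is dominated by a multiple of \<open>\<mu> s\<close>, so the action at time
  \<open>s\<close> is at most a constant times the integral of \<open>F(\<rho> s)\<close>, where \<open>F(r) = r\<^sup>2 / m r\<close> and \<open>\<rho> s\<close> is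
  the density of \<open>\<mu> s\<close>. For \<open>s \<le> 1/2\<close>, \<open>\<rho> s\<close> is an average of translates of a dilation of \<open>\<rho>0\<close>
  by a factor of at least \<open>1/2\<close>; as \<open>F\<close> is convex and \<open>F(l r) \<le> l\<^sup>2 F(r)\<close> for \<open>l \<ge> 1\<close>, Jensen's
  inequality bounds the integral of \<open>F(\<rho> s)\<close> by \<open>2^d\<close> times that of \<open>F(\<rho>0)\<close>. For \<open>s \<ge> 1/2\<close> the
  roles of \<open>\<rho>0\<close> and \<open>\<rho>1\<close> are exchanged.\<close>

section \<open>Mobilities\<close>

lemma mobility_nonneg: "mobility m \<Longrightarrow> 0 \<le> r \<Longrightarrow> 0 \<le> m r"
  by (auto simp: mobility_def)

lemma mobility_pos: "mobility m \<Longrightarrow> 0 < r \<Longrightarrow> 0 < m r"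
  by (auto simp: mobility_def)

text \<open>Convexity of \<open>- m\<close> supplies a subgradient at the interior point
  \<open>s\<close>. Its sign is forced by the half line: a descending supporting line would
  eventually push \<open>m\<close> below 0.\<close>

lemma mobility_supporting_line:
  assumes m: "mobility m" and s: "0 < s"
  obtains q where "0 \<le> q" "\<And>r. 0 \<le> r \<Longrightarrow> m r \<le> m s + q * (r - s)"
proof -
  have cv: "convex_on {0..} (\<lambda>r. - m r)"
    using m by (simp add: mobility_def concave_on_def)
  have int: "s \<in> interior {0..}"
    using s by (simp add: interior_real_atLeast)
  obtain q where q: "\<And>r. 0 \<le> r \<Longrightarrow> m r \<le> m s + q * (r - s)"
    using convex_le_Inf_differential[OF cv int]
    by (metis (no_types, lifting) add.inverse_inverse atLeast_iff minus_add_distrib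
        minus_le_iff minus_mult_minus mult_minus_left)
  have "0 \<le> q"
  proof (rule ccontr)
    assume "\<not> 0 \<le> q"
    then have q0: "q < 0" by simp
    \<comment> \<open>Chosen so that the supporting line takes the value -1 there.\<close>
    let ?r = "s + (m s + 1) / (- q)"
    have "0 < m s" using mobility_pos[OF m s] .
    then have r: "0 \<le> ?r" using q0 s by (intro add_nonneg_nonneg divide_nonneg_pos) auto
    have "q * (?r - s) = - (m s + 1)" using q0 by (simp add: field_simps)
    then show False using q[OF r] mobility_nonneg[OF m r] by linarith
  qed
  with q that show thesis by blast
qed

text \<open>The supporting line at the larger point has nonnegative slope, so to the left of
  \<open>s\<close> it does not exceed \<open>m s\<close>.\<close>

lemma mobility_mono:
  assumes m: "mobility m" and "0 \<le> r" "r \<le> s"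
  shows "m r \<le> m s"
proof (cases "s = 0")
  case False
  then have "0 < s" using assms by simp
  from mobility_supporting_line[OF m this] obtain q
    where "0 \<le> q" "\<And>r. 0 \<le> r \<Longrightarrow> m r \<le> m s + q * (r - s)" by blast
  then have "m r \<le> m s + q * (r - s)" "q * (r - s) \<le> 0"
    using assms by (auto simp: mult_nonneg_nonpos)
  then show ?thesis by linarith
qed (use assms in auto)

text \<open>Continuity of \<open>m\<close> is known only on \<open>{0..}\<close>; composing with
  \<open>max 0\<close> gives a function that is continuous on the whole line and has the same values
  along \<open>f\<close>.\<close>

lemma borel_measurable_mobility:
  assumes m: "mobility m" and f: "f \<in> borel_measurable M" and nn: "\<And>x. 0 \<le> f x"
  shows "(\<lambda>x. m (f x)) \<in> borel_measurable M"
proof -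
  have "continuous_on UNIV (\<lambda>x. m (max 0 x))"
    by (rule continuous_on_compose2[where g = m and t = "{0..}"])
       (use m in \<open>auto simp: mobility_def intro!: continuous_intros\<close>)
  then have "(\<lambda>x. m (max 0 x)) \<in> borel_measurable borel"
    by (rule borel_measurable_continuous_onI)
  from measurable_compose[OF f this] show ?thesis
    using nn by (simp add: max_absorb2)
qed

text \<open>As \<open>m\<close> is nondecreasing, passing from \<open>m r\<close> to
  \<open>m (l * r)\<close> can only enlarge the denominator. At \<open>r = 0\<close>, where
  \<open>m\<close> may vanish, both sides are 0.\<close>

lemma square_div_mobility_scale:
  assumes m: "mobility m" and "1 \<le> l" "0 \<le> r"
  shows "(l * r)\<^sup>2 / m (l * r) \<le> l\<^sup>2 * (r\<^sup>2 / m r)"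
proof (cases "r = 0")
  case False
  have "r \<le> l * r" using assms by (simp add: mult_le_cancel_right1)
  then have "m r \<le> m (l * r)" using mobility_mono[OF m] assms by blast
  moreover have "0 < m r" using mobility_pos[OF m] False assms by simp
  ultimately have "(l * r)\<^sup>2 / m (l * r) \<le> (l * r)\<^sup>2 / m r"
    by (intro divide_left_mono mult_pos_pos) auto
  then show ?thesis by (simp add: power_mult_distrib)
qed simp

text \<open>The function \<open>r\<^sup>2 / m r\<close> is the supremum over \<open>a\<close> of the convex functions
  \<open>2 a r - a\<^sup>2 m r\<close>, attained at \<open>a = r / m r\<close>.\<close>

lemma square_div_mobility_supporting_line:
  assumes m: "mobility m" and s: "0 < s"
  obtains p where "0 \<le> p" "\<And>r. 0 \<le> r \<Longrightarrow> s\<^sup>2 / m s + p * (r - s) \<le> r\<^sup>2 / m r"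
proof -
  obtain q where q: "0 \<le> q" "\<And>r. 0 \<le> r \<Longrightarrow> m r \<le> m s + q * (r - s)"
    using mobility_supporting_line[OF m s] by blast
  have ms: "0 < m s" using mobility_pos[OF m s] .
  define a where "a = s / m s"
  have a0: "0 \<le> a" and as: "a * m s = s" using s ms by (auto simp: a_def)
  \<comment> \<open>The line is evaluated at 0, where \<open>m\<close> is nonnegative. This leads to
    \<open>a * q \<le> 1\<close> and so to a nonnegative slope \<open>2 * a - a\<^sup>2 * q\<close>,
    which is what allows integration of the line in \<open>ennreal\<close>.\<close>
  have "q * s \<le> m s" using q(2)[of 0] mobility_nonneg[OF m, of 0] by simp
  then have "a * (q * s) \<le> a * m s" using a0 by (rule mult_left_mono)
  then have "(a * q) * s \<le> 1 * s" using as by (simp add: mult.assoc)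
  then have "a * q \<le> 1" using s mult_le_cancel_right_pos by blast
  then have "a * (a * q) \<le> a * 1" using a0 by (rule mult_left_mono)
  then have p0: "0 \<le> 2 * a - a\<^sup>2 * q" using a0 by (simp add: power2_eq_square)
  have eq: "s\<^sup>2 / m s = 2 * a * s - a\<^sup>2 * m s"
    using ms by (simp add: a_def field_simps power2_eq_square)
  have "s\<^sup>2 / m s + (2 * a - a\<^sup>2 * q) * (r - s) \<le> r\<^sup>2 / m r" if r: "0 \<le> r" for r
  proof -
    have "a\<^sup>2 * m r \<le> a\<^sup>2 * (m s + q * (r - s))"
      using q(2)[OF r] by (rule mult_left_mono) simp
    then have "s\<^sup>2 / m s + (2 * a - a\<^sup>2 * q) * (r - s) \<le> 2 * a * r - a\<^sup>2 * m r"
      by (simp add: eq algebra_simps)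
    also have "\<dots> \<le> r\<^sup>2 / m r"
    proof (cases "r = 0")
      case True
      then show ?thesis using mobility_nonneg[OF m, of 0] by simp
    next
      case False
      then have mr: "0 < m r" using mobility_pos[OF m] r by simp
      have "0 \<le> (r - a * m r)\<^sup>2" by simp
      then have "(2 * a * r - a\<^sup>2 * m r) * m r \<le> r\<^sup>2"
        by (simp add: power2_eq_square algebra_simps)
      then show ?thesis using mr by (simp add: pos_le_divide_eq)
    qed
    finally show ?thesis .
  qed
  with p0 that show thesis by blast
qed

lemma square_div_mobility_nonneg: "mobility m \<Longrightarrow> 0 \<le> r \<Longrightarrow> 0 \<le> r\<^sup>2 / m r"
  using mobility_nonneg by simp

text \<open>The supporting line at the mean \<open>r\<close> is integrated. The right side may be
  infinite, so the inequality is arranged with nonnegative terms only, and the finite term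
  \<open>p * r\<close> is cancelled at the end. At \<open>r = 0\<close> the left side is 0.\<close>

lemma square_div_mobility_jensen:
  assumes m: "mobility m" and P: "prob_space P"
    and k[measurable]: "k \<in> borel_measurable P" and nn: "\<And>x. 0 \<le> k x"
    and r: "(\<integral>\<^sup>+x. ennreal (k x) \<partial>P) = ennreal r" "0 \<le> r"
  shows "ennreal (r\<^sup>2 / m r) \<le> (\<integral>\<^sup>+x. ennreal ((k x)\<^sup>2 / m (k x)) \<partial>P)"
proof (cases "r = 0")
  case False
  interpret prob_space P by fact
  note [measurable] = borel_measurable_mobility[OF m k nn]
  have "0 < r" using False r by simp
  then obtain p where p: "0 \<le> p" "\<And>s. 0 \<le> s \<Longrightarrow> r\<^sup>2 / m r + p * (s - r) \<le> s\<^sup>2 / m s"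
    using square_div_mobility_supporting_line[OF m] by blast
  have F: "0 \<le> s\<^sup>2 / m s" if "0 \<le> s" for s
    using square_div_mobility_nonneg[OF m that] .
  have "ennreal (p * r) + ennreal (r\<^sup>2 / m r)
      = (\<integral>\<^sup>+x. ennreal (r\<^sup>2 / m r) + ennreal p * ennreal (k x) \<partial>P)"
    using p(1) r by (simp add: nn_integral_add nn_integral_cmult emeasure_space_1
        ennreal_mult add.commute)
  also have "\<dots> \<le> (\<integral>\<^sup>+x. ennreal ((k x)\<^sup>2 / m (k x)) + ennreal (p * r) \<partial>P)"
  proof (rule nn_integral_mono)
    fix x
    have "r\<^sup>2 / m r + p * k x \<le> (k x)\<^sup>2 / m (k x) + p * r"
      using p(2)[OF nn, of x] by (simp add: algebra_simps)
    then show "ennreal (r\<^sup>2 / m r) + ennreal p * ennreal (k x)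
        \<le> ennreal ((k x)\<^sup>2 / m (k x)) + ennreal (p * r)"
      using F[OF r(2)] F[OF nn, of x] p(1) nn[of x] r(2)
      by (simp flip: ennreal_plus ennreal_mult add: ennreal_leI)
  qed
  also have "\<dots> = ennreal (p * r) + (\<integral>\<^sup>+x. ennreal ((k x)\<^sup>2 / m (k x)) \<partial>P)"
    by (simp add: nn_integral_add emeasure_space_1 add.commute)
  finally show ?thesis
    by (simp add: ennreal_add_left_cancel_le)
qed simp

section \<open>The density of an interpolated measure\<close>

text \<open>The substitution is \<open>z = a *\<^sub>R x + t\<close>, and the factor is its inverse
  Jacobian.\<close>

lemma nn_integral_lborel_affine:
  fixes f :: "'a::euclidean_space \<Rightarrow> ennreal"
  assumes "0 < a" and f[measurable]: "f \<in> borel_measurable borel"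
  shows "(\<integral>\<^sup>+x. f x \<partial>lborel)
    = ennreal (1 / a ^ DIM('a)) * (\<integral>\<^sup>+z. f ((z - t) /\<^sub>R a) \<partial>lborel)"
proof -
  have "(\<integral>\<^sup>+x. f x \<partial>lborel)
      = (\<integral>\<^sup>+x. f x \<partial>density (distr lborel borel (\<lambda>x. - (t /\<^sub>R a) + (1/a) *\<^sub>R x)) (\<lambda>_. \<bar>1/a\<bar>^DIM('a)))"
    using assms(1) by (subst lborel_affine[of "1/a" "- (t /\<^sub>R a)"]) auto
  also have "\<dots> = ennreal (\<bar>1/a\<bar>^DIM('a)) * (\<integral>\<^sup>+z. f (- (t /\<^sub>R a) + (1/a) *\<^sub>R z) \<partial>lborel)"
    by (simp add: nn_integral_density nn_integral_distr nn_integral_cmult)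
  finally show ?thesis
    using assms(1) by (simp add: power_one_over inverse_eq_divide algebra_simps)
qed

text \<open>For fixed \<open>y\<close> the image of \<open>r\<close> is a dilated translate
  \<open>k z y\<close>, and averaging it over \<open>P\<close> gives the density of the image
  measure. Jensen under \<open>P\<close> moves the convex function inside the average, scaling costs
  a factor \<open>l\<^sup>2\<close>, and undoing the substitution gives back one factor
  \<open>l\<close>; what remains is \<open>l \<le> 2 ^ DIM('a)\<close>.\<close>

lemma distr_affine_sum_density:
  fixes r :: "'a::euclidean_space \<Rightarrow> real"
  assumes m: "mobility m" and r[measurable]: "r \<in> borel_measurable borel"
    and nn: "\<And>x. 0 \<le> r x"
    and fin: "finite_measure (density lborel (\<lambda>x. ennreal (r x)))"
    and P: "prob_space P" and sP[measurable_cong]: "sets P = sets borel"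
    and a: "1/2 \<le> a" "a \<le> 1"
  obtains \<rho> where "\<rho> \<in> borel_measurable borel" "\<And>z. 0 \<le> \<rho> z"
    "distr (density lborel (\<lambda>x. ennreal (r x)) \<Otimes>\<^sub>M P) borel (\<lambda>(x, y). a *\<^sub>R x + b *\<^sub>R y)
      = density lborel (\<lambda>z. ennreal (\<rho> z))"
    "(\<integral>\<^sup>+z. ennreal ((\<rho> z)\<^sup>2 / m (\<rho> z)) \<partial>lborel)
      \<le> ennreal (2 ^ DIM('a)) * (\<integral>\<^sup>+x. ennreal ((r x)\<^sup>2 / m (r x)) \<partial>lborel)"
proof -
  interpret P: prob_space P by fact
  let ?M = "density lborel (\<lambda>x. ennreal (r x))"
  interpret M: finite_measure ?M by fact
  interpret PL: pair_sigma_finite lborel P ..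
  interpret PM: pair_sigma_finite ?M P ..
  have a0: "0 < a" using a by simp
  \<comment> \<open>The Jacobian factor: \<open>a \<le> 1\<close> gives \<open>1 \<le> l\<close>, as
    the scaling inequality requires, and \<open>1/2 \<le> a\<close> gives
    \<open>l \<le> 2 ^ DIM('a)\<close>.\<close>
  define l where "l = 1 / a ^ DIM('a)"
  have a_pow: "0 < a ^ DIM('a)" "a ^ DIM('a) \<le> 1" "(1/2) ^ DIM('a) \<le> a ^ DIM('a)"
    using a a0 by (auto intro: power_le_one power_mono)
  have l1: "1 \<le> l" unfolding l_def using a_pow by simp
  have l2: "l \<le> 2 ^ DIM('a)"
    unfolding l_def using a_pow by (simp add: field_simps power_one_over)
  define k where "k = (\<lambda>z y. l * r ((z - b *\<^sub>R y) /\<^sub>R a))"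
  have k0: "0 \<le> k z y" for z y unfolding k_def using nn l1 by simp
  have k[measurable]: "(\<lambda>(z, y). k z y) \<in> borel_measurable (borel \<Otimes>\<^sub>M borel)"
    unfolding k_def by measurable
  define h where "h = (\<lambda>z. \<integral>\<^sup>+y. ennreal (k z y) \<partial>P)"
  have h[measurable]: "h \<in> borel_measurable borel" unfolding h_def by measurable
  have dist: "distr (?M \<Otimes>\<^sub>M P) borel (\<lambda>(x, y). a *\<^sub>R x + b *\<^sub>R y) = density lborel h"
  proof (rule measure_eqI)
    fix A :: "'a set" assume "A \<in> sets (distr (?M \<Otimes>\<^sub>M P) borel (\<lambda>(x, y). a *\<^sub>R x + b *\<^sub>R y))"
    then have A[measurable]: "A \<in> sets borel" by simp
    have "emeasure (distr (?M \<Otimes>\<^sub>M P) borel (\<lambda>(x, y). a *\<^sub>R x + b *\<^sub>R y)) A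
        = (\<integral>\<^sup>+p. indicator A p \<partial>distr (?M \<Otimes>\<^sub>M P) borel (\<lambda>(x, y). a *\<^sub>R x + b *\<^sub>R y))"
      by (rule nn_integral_indicator[symmetric]) simp
    also have "\<dots> = (\<integral>\<^sup>+p. indicator A (a *\<^sub>R fst p + b *\<^sub>R snd p) \<partial>(?M \<Otimes>\<^sub>M P))"
      by (subst nn_integral_distr) (auto simp: case_prod_beta)
    also have "\<dots> = (\<integral>\<^sup>+y. \<integral>\<^sup>+x. indicator A (a *\<^sub>R x + b *\<^sub>R y) \<partial>?M \<partial>P)"
      by (subst PM.nn_integral_snd[symmetric]) auto
    also have "\<dots> = (\<integral>\<^sup>+y. \<integral>\<^sup>+x. ennreal (r x) * indicator A (a *\<^sub>R x + b *\<^sub>R y) \<partial>lborel \<partial>P)"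
      by (intro nn_integral_cong nn_integral_density) auto
    also have "\<dots> = (\<integral>\<^sup>+y. \<integral>\<^sup>+z. ennreal (k z y) * indicator A z \<partial>lborel \<partial>P)"
    proof (rule nn_integral_cong)
      fix y
      have "(\<integral>\<^sup>+x. ennreal (r x) * indicator A (a *\<^sub>R x + b *\<^sub>R y) \<partial>lborel)
          = ennreal l * (\<integral>\<^sup>+z. ennreal (r ((z - b *\<^sub>R y) /\<^sub>R a)) * indicator A z \<partial>lborel)"
        by (subst nn_integral_lborel_affine[OF a0, where t = "b *\<^sub>R y"])
           (use a0 in \<open>auto simp: l_def\<close>)
      also have "\<dots> = (\<integral>\<^sup>+z. ennreal (k z y) * indicator A z \<partial>lborel)"
        unfolding k_def using l1
        by (subst nn_integral_cmult[symmetric]) (auto simp: ennreal_mult nn mult.assoc)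
      finally show "(\<integral>\<^sup>+x. ennreal (r x) * indicator A (a *\<^sub>R x + b *\<^sub>R y) \<partial>lborel)
          = (\<integral>\<^sup>+z. ennreal (k z y) * indicator A z \<partial>lborel)" .
    qed
    also have "\<dots> = (\<integral>\<^sup>+z. \<integral>\<^sup>+y. ennreal (k z y) * indicator A z \<partial>P \<partial>lborel)"
      by (rule PL.Fubini') measurable
    also have "\<dots> = (\<integral>\<^sup>+z. h z * indicator A z \<partial>lborel)"
      unfolding h_def by (intro nn_integral_cong nn_integral_multc) measurable
    also have "\<dots> = emeasure (density lborel h) A"
      by (rule emeasure_density[symmetric]) auto
    finally show "emeasure (distr (?M \<Otimes>\<^sub>M P) borel (\<lambda>(x, y). a *\<^sub>R x + b *\<^sub>R y)) A
        = emeasure (density lborel h) A" .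
  qed simp
  \<comment> \<open>Finite total mass makes \<open>h\<close> finite almost everywhere, so a
    real-valued density can replace it.\<close>
  have "finite_measure (?M \<Otimes>\<^sub>M P)"
    by (rule finite_measure_pair_measure) unfold_locales
  then have fd: "finite_measure (distr (?M \<Otimes>\<^sub>M P) borel (\<lambda>(x, y). a *\<^sub>R x + b *\<^sub>R y))"
    by (rule finite_measure.finite_measure_distr) measurable
  have "(\<integral>\<^sup>+z. h z \<partial>lborel) = emeasure (density lborel h) UNIV"
    by (subst emeasure_density) auto
  also have "\<dots> \<noteq> \<infinity>"
    using finite_measure.emeasure_finite[OF fd, of UNIV] by (simp add: dist)
  finally have hfin: "AE z in lborel. h z \<noteq> \<infinity>"
    by (intro nn_integral_PInf_AE) auto
  define \<rho> where "\<rho> = (\<lambda>z. enn2real (h z))"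
  have \<rho>: "\<rho> \<in> borel_measurable borel" "\<And>z. 0 \<le> \<rho> z" unfolding \<rho>_def by auto
  have h\<rho>: "AE z in lborel. h z = ennreal (\<rho> z)"
    using hfin by eventually_elim (simp add: \<rho>_def less_top)
  have dens: "density lborel h = density lborel (\<lambda>z. ennreal (\<rho> z))"
    by (rule density_cong) (use h\<rho> \<rho> in auto)
  have [measurable]: "(\<lambda>x. m (r x)) \<in> borel_measurable borel"
    by (rule borel_measurable_mobility[OF m r nn])
  have "(\<integral>\<^sup>+z. ennreal ((\<rho> z)\<^sup>2 / m (\<rho> z)) \<partial>lborel)
      \<le> (\<integral>\<^sup>+z. \<integral>\<^sup>+y. ennreal (l\<^sup>2) * ennreal ((r ((z - b *\<^sub>R y) /\<^sub>R a))\<^sup>2 / m (r ((z - b *\<^sub>R y) /\<^sub>R a))) \<partial>P \<partial>lborel)"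
  proof (rule nn_integral_mono_AE, use h\<rho> in eventually_elim)
    fix z assume "h z = ennreal (\<rho> z)"
    \<comment> \<open>At such a point \<open>z\<close>, the mean of \<open>k z\<close> under
      \<open>P\<close> is the real number \<open>\<rho> z\<close>, as Jensen requires.\<close>
    then have "ennreal ((\<rho> z)\<^sup>2 / m (\<rho> z)) \<le> (\<integral>\<^sup>+y. ennreal ((k z y)\<^sup>2 / m (k z y)) \<partial>P)"
      unfolding h_def by (intro square_div_mobility_jensen[OF m P _ k0 _ \<rho>(2)]) measurable
    also have "\<dots> \<le> (\<integral>\<^sup>+y. ennreal (l\<^sup>2) * ennreal ((r ((z - b *\<^sub>R y) /\<^sub>R a))\<^sup>2 / m (r ((z - b *\<^sub>R y) /\<^sub>R a))) \<partial>P)"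
    proof (rule nn_integral_mono)
      fix y
      let ?r = "r ((z - b *\<^sub>R y) /\<^sub>R a)"
      have "(k z y)\<^sup>2 / m (k z y) \<le> l\<^sup>2 * (?r\<^sup>2 / m ?r)"
        unfolding k_def by (rule square_div_mobility_scale[OF m l1 nn])
      then have "ennreal ((k z y)\<^sup>2 / m (k z y)) \<le> ennreal (l\<^sup>2 * (?r\<^sup>2 / m ?r))"
        by (rule ennreal_leI)
      also have "\<dots> = ennreal (l\<^sup>2) * ennreal (?r\<^sup>2 / m ?r)"
        by (rule ennreal_mult) (simp, rule square_div_mobility_nonneg[OF m nn])
      finally show "ennreal ((k z y)\<^sup>2 / m (k z y)) \<le> ennreal (l\<^sup>2) * ennreal (?r\<^sup>2 / m ?r)" .
    qed
    finally show "ennreal ((\<rho> z)\<^sup>2 / m (\<rho> z)) \<le> \<dots>" .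
  qed
  also have "\<dots> = (\<integral>\<^sup>+y. \<integral>\<^sup>+z. ennreal (l\<^sup>2) * ennreal ((r ((z - b *\<^sub>R y) /\<^sub>R a))\<^sup>2 / m (r ((z - b *\<^sub>R y) /\<^sub>R a))) \<partial>lborel \<partial>P)"
    by (rule PL.Fubini'[symmetric]) measurable
  also have "\<dots> = (\<integral>\<^sup>+y. ennreal l * (\<integral>\<^sup>+x. ennreal ((r x)\<^sup>2 / m (r x)) \<partial>lborel) \<partial>P)"
  proof (rule nn_integral_cong)
    fix y
    \<comment> \<open>One of the two factors is matched by the Jacobian from the substitution on the
      right side; the other one stays.\<close>
    have "ennreal (l\<^sup>2) = ennreal l * ennreal l"
      using l1 by (simp add: power2_eq_square ennreal_mult)
    then show "(\<integral>\<^sup>+z. ennreal (l\<^sup>2) * ennreal ((r ((z - b *\<^sub>R y) /\<^sub>R a))\<^sup>2 / m (r ((z - b *\<^sub>R y) /\<^sub>R a))) \<partial>lborel)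
       = ennreal l * (\<integral>\<^sup>+x. ennreal ((r x)\<^sup>2 / m (r x)) \<partial>lborel)"
      by (subst nn_integral_lborel_affine[OF a0, of "\<lambda>x. ennreal ((r x)\<^sup>2 / m (r x))" "b *\<^sub>R y"])
         (auto simp: nn_integral_cmult l_def mult.assoc)
  qed
  also have "\<dots> = ennreal l * (\<integral>\<^sup>+x. ennreal ((r x)\<^sup>2 / m (r x)) \<partial>lborel)"
    by (simp add: P.emeasure_space_1)
  also have "\<dots> \<le> ennreal (2 ^ DIM('a)) * (\<integral>\<^sup>+x. ennreal ((r x)\<^sup>2 / m (r x)) \<partial>lborel)"
    by (intro mult_right_mono ennreal_leI l2) simp
  finally show thesis
    using that[OF \<rho>] dist dens by simp
qed

section \<open>Vector measures with a density\<close>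

text \<open>\<open>B\<close> and \<open>A - B\<close> form one of the partitions in the
  supremum.\<close>

lemma norm_le_total_variation:
  assumes "A \<in> sets borel" "B \<in> sets borel" "B \<subseteq> A"
  shows "ennreal (norm (\<nu> B)) \<le> total_variation \<nu> A"
proof -
  let ?P = "{B, A - B}"
  have "?P \<in> {P. finite P \<and> P \<subseteq> sets borel \<and> disjoint P \<and> \<Union>P = A}"
    using assms by (auto simp: disjoint_def)
  then have "(\<Sum>B\<in>?P. ennreal (norm (\<nu> B))) \<le> total_variation \<nu> A"
    unfolding total_variation_def by (rule SUP_upper)
  moreover have "ennreal (norm (\<nu> B)) \<le> (\<Sum>B\<in>?P. ennreal (norm (\<nu> B)))"
    by (rule member_le_sum) auto
  ultimately show ?thesis by order
qed

text \<open>Additivity of \<open>\<mu>\<close> turns the bounds on the pieces into the same bound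
  for each partition, hence for the supremum.\<close>

lemma total_variation_le:
  assumes \<mu>: "sets \<mu> = sets borel"
    and le: "\<And>B. B \<in> sets borel \<Longrightarrow> ennreal (norm (\<nu> B)) \<le> C * emeasure \<mu> B"
  shows "total_variation \<nu> A \<le> C * emeasure \<mu> A"
  unfolding total_variation_def
proof (rule SUP_least)
  fix P assume "P \<in> {P. finite P \<and> P \<subseteq> sets borel \<and> disjoint P \<and> \<Union>P = A}"
  then have P: "finite P" "P \<subseteq> sets borel" "disjoint P" "\<Union>P = A" by auto
  have "(\<Sum>B\<in>P. ennreal (norm (\<nu> B))) \<le> (\<Sum>B\<in>P. C * emeasure \<mu> B)"
    using P le by (intro sum_mono) auto
  also have "\<dots> = C * emeasure \<mu> (\<Union>B\<in>P. B)"
    using P \<mu> by (subst sum_emeasure[symmetric])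
      (auto simp: sum_distrib_left disjoint_def disjoint_family_on_def)
  finally show "(\<Sum>B\<in>P. ennreal (norm (\<nu> B))) \<le> C * emeasure \<mu> A"
    using P by simp
qed

section \<open>Lebesgue decompositions of positive measures with a density\<close>

lemma eq_null_measure_if_emeasure_zero:
  assumes "sets \<mu> = sets borel" "\<And>A. A \<in> sets borel \<Longrightarrow> emeasure \<mu> A = 0"
  shows "\<mu> = null_measure borel"
  using assms by (intro measure_eqI) auto

lemma lebesgue_decomp_density:
  fixes \<rho> :: "'a::euclidean_space \<Rightarrow> real"
  assumes "integrable lborel \<rho>" "\<And>x. 0 \<le> \<rho> x"
  shows "lebesgue_decomp (density lborel (\<lambda>x. ennreal (\<rho> x))) \<rho> (null_measure borel)"
proof -
  have "\<rho> \<in> borel_measurable borel" using assms(1) by auto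
  moreover have "finite_measure (null_measure (borel :: 'a measure))"
    by (rule finite_measureI) simp
  moreover have "\<exists>N. N \<in> null_sets (lborel :: 'a measure)" by blast
  ultimately show ?thesis
    using assms by (auto simp: lebesgue_decomp_def pos_measures_def emeasure_density)
qed

text \<open>\<open>ac_dens\<close> and \<open>sing_part\<close> are defined by choice and by
  description, so uniqueness is what gives access to their values. Removing the null set
  \<open>N\<close> that carries \<open>\<mu>s\<close> leaves Lebesgue integrals unchanged, so the
  two densities have equal integrals over each Borel set; subtracting these finite integrals leaves
  \<open>\<mu>s = 0\<close>.\<close>

lemma lebesgue_decomp_density_unique:
  fixes \<rho> :: "'a::euclidean_space \<Rightarrow> real"
  assumes \<rho>: "integrable lborel \<rho>" "\<And>x. 0 \<le> \<rho> x"
    and dec: "lebesgue_decomp (density lborel (\<lambda>x. ennreal (\<rho> x))) \<rho>' \<mu>s"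
  shows "AE x in lborel. \<rho>' x = \<rho> x" "\<mu>s = null_measure borel"
proof -
  let ?d = "\<lambda>\<rho> A. \<integral>\<^sup>+x\<in>A. ennreal (\<rho> x) \<partial>lborel"
  have [measurable]: "\<rho> \<in> borel_measurable borel" using \<rho> by auto
  obtain N where N: "N \<in> null_sets lborel" "emeasure \<mu>s (- N) = 0"
    and \<rho>': "integrable lborel \<rho>'" "\<And>x. 0 \<le> \<rho>' x"
    and s: "sets \<mu>s = sets borel"
    and eq: "\<And>A. A \<in> sets borel \<Longrightarrow> ?d \<rho> A = ?d \<rho>' A + emeasure \<mu>s A"
    using dec by (auto simp: lebesgue_decomp_def pos_measures_def emeasure_density)
  have [measurable]: "\<rho>' \<in> borel_measurable borel" using \<rho>' by auto
  have N'[measurable]: "N \<in> sets borel" using N by auto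
  have AEN: "AE x in lborel. x \<notin> N" using N(1) by (rule AE_not_in)
  have cut: "?d r A = ?d r (A - N)" for r :: "'a \<Rightarrow> real" and A
    by (rule nn_integral_cong_AE) (use AEN in eventually_elim, auto simp: indicator_def)
  have ae: "?d \<rho> A = ?d \<rho>' A" if A: "A \<in> sets borel" for A
  proof -
    have "emeasure \<mu>s (A - N) \<le> emeasure \<mu>s (- N)"
      using N' s by (intro emeasure_mono) (auto simp: Compl_in_sets_lebesgue)
    then have "emeasure \<mu>s (A - N) = 0" using N by simp
    then show ?thesis
      using eq[of "A - N"] A N' cut[of \<rho> A] cut[of \<rho>' A] by (simp add: sets.Diff)
  qed
  have fin: "?d \<rho>' A \<noteq> \<infinity>" if "A \<in> sets borel" for A
  proof -
    have "?d \<rho>' A \<le> (\<integral>\<^sup>+x. ennreal (\<rho>' x) \<partial>lborel)"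
      by (rule nn_integral_mono) (auto simp: indicator_def)
    also have "\<dots> < \<infinity>" using \<rho>' by (simp add: integrable_iff_bounded)
    finally show ?thesis by simp
  qed
  have "emeasure \<mu>s A = 0" if A: "A \<in> sets borel" for A
  proof -
    have "?d \<rho>' A + emeasure \<mu>s A = ?d \<rho>' A + 0"
      using eq[OF A] ae[OF A] by simp
    then show ?thesis using fin[OF A] ennreal_add_left_cancel[of "?d \<rho>' A"] by auto
  qed
  with s show "\<mu>s = null_measure borel" by (rule eq_null_measure_if_emeasure_zero)
  have "density lborel (\<lambda>x. ennreal (\<rho> x)) = density lborel (\<lambda>x. ennreal (\<rho>' x))"
    by (rule measure_eqI) (auto simp: emeasure_density ae)
  then have "AE x in lborel. ennreal (\<rho> x) = ennreal (\<rho>' x)"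
    by (subst (asm) sigma_finite_measure.density_unique_iff[OF sigma_finite_lborel]) auto
  then show "AE x in lborel. \<rho>' x = \<rho> x"
    by eventually_elim (use \<rho> \<rho>' in simp)
qed

lemma ac_dens_density:
  fixes \<rho> :: "'a::euclidean_space \<Rightarrow> real"
  assumes \<rho>: "integrable lborel \<rho>" "\<And>x. 0 \<le> \<rho> x"
  defines "\<mu> \<equiv> density lborel (\<lambda>x. ennreal (\<rho> x))"
  shows "AE x in lborel. ac_dens \<mu> x = \<rho> x"
proof -
  have "\<exists>\<mu>s. lebesgue_decomp \<mu> (ac_dens \<mu>) \<mu>s"
    unfolding ac_dens_def \<mu>_def
    by (rule someI_ex[of "\<lambda>\<rho>'. \<exists>\<mu>s. lebesgue_decomp _ \<rho>' \<mu>s"])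
       (use lebesgue_decomp_density[OF \<rho>] in blast)
  then show ?thesis
    unfolding \<mu>_def using lebesgue_decomp_density_unique(1)[OF \<rho>] by blast
qed

lemma sing_part_density:
  fixes \<rho> :: "'a::euclidean_space \<Rightarrow> real"
  assumes \<rho>: "integrable lborel \<rho>" "\<And>x. 0 \<le> \<rho> x"
  shows "sing_part (density lborel (\<lambda>x. ennreal (\<rho> x))) = null_measure borel"
  unfolding sing_part_def
  by (rule the_equality)
     (use lebesgue_decomp_density[OF \<rho>] lebesgue_decomp_density_unique(2)[OF \<rho>] in blast)+

section \<open>Lebesgue decompositions of vector measures with a density\<close>

lemma total_variation_zero: "total_variation (\<lambda>A. 0) A = 0"
  by (auto simp: total_variation_def intro!: antisym SUP_least)

lemma vec_lebesgue_decomp_density: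
  assumes "integrable lborel w" "\<And>A. A \<in> sets borel \<Longrightarrow> \<nu> A = (LINT x:A|lborel. w x)"
  shows "vec_lebesgue_decomp \<nu> w (\<lambda>A. 0)"
proof -
  have "\<exists>N. N \<in> null_sets (lborel :: 'a measure)" by blast
  then show ?thesis
    using assms by (auto simp: vec_lebesgue_decomp_def vector_measure_def total_variation_zero)
qed

text \<open>As in the scalar case, a null set carrying \<open>\<nu>s\<close> is cut away. Equality
  with the zero function holds on all sets, including non-Borel ones, because a vector measure is 0
  there by convention.\<close>

lemma vec_lebesgue_decomp_density_unique:
  fixes w :: "'a::euclidean_space \<Rightarrow> 'a"
  assumes w: "integrable lborel w"
    and \<nu>: "\<And>A. A \<in> sets borel \<Longrightarrow> \<nu> A = (LINT x:A|lborel. w x)"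
    and dec: "vec_lebesgue_decomp \<nu> w' \<nu>s"
  shows "AE x in lborel. w' x = w x" "\<nu>s = (\<lambda>A. 0)"
proof -
  obtain N where N: "N \<in> null_sets lborel" "total_variation \<nu>s (- N) = 0"
    and w': "integrable lborel w'"
    and vm: "vector_measure \<nu>s"
    and eq: "\<And>A. A \<in> sets borel \<Longrightarrow> \<nu> A = (LINT x:A|lborel. w' x) + \<nu>s A"
    using dec by (auto simp: vec_lebesgue_decomp_def)
  have [measurable]: "w \<in> borel_measurable borel" "w' \<in> borel_measurable borel"
    using w w' by auto
  have N'[measurable]: "N \<in> sets borel" using N by auto
  have AEN: "AE x in lborel. x \<notin> N" using N(1) by (rule AE_not_in)
  have cut: "(LINT x:A|lborel. v x) = (LINT x:A - N|lborel. v x)"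
    if [measurable]: "v \<in> borel_measurable borel" "A \<in> sets borel" for v :: "'a \<Rightarrow> 'a" and A
    unfolding set_lebesgue_integral_def
    by (rule integral_cong_AE) (measurable, use AEN in eventually_elim, auto simp: indicator_def)
  have ae: "(LINT x:A|lborel. w' x) = (LINT x:A|lborel. w x)" if A: "A \<in> sets borel" for A
  proof -
    have "ennreal (norm (\<nu>s (A - N))) \<le> total_variation \<nu>s (- N)"
      using A N' by (intro norm_le_total_variation) auto
    then have "\<nu>s (A - N) = 0" using N by simp
    then show ?thesis
      using eq[of "A - N"] \<nu>[of "A - N"] A N' cut[of w A] cut[of w' A] by (simp add: sets.Diff)
  qed
  show "AE x in lborel. w' x = w x"
    by (rule sigma_finite_measure.density_unique_banach[OF sigma_finite_lborel w' w]) (simp add: ae)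
  show "\<nu>s = (\<lambda>A. 0)"
  proof
    fix A show "\<nu>s A = 0"
    proof (cases "A \<in> sets borel")
      case True
      then show ?thesis using eq[OF True] \<nu>[OF True] ae[OF True] by simp
    next
      case False
      then show ?thesis using vm by (simp add: vector_measure_def)
    qed
  qed
qed

lemma vec_ac_dens_density:
  assumes w: "integrable lborel w" "\<And>A. A \<in> sets borel \<Longrightarrow> \<nu> A = (LINT x:A|lborel. w x)"
  shows "AE x in lborel. vec_ac_dens \<nu> x = w x"
proof -
  have "\<exists>\<nu>s. vec_lebesgue_decomp \<nu> (vec_ac_dens \<nu>) \<nu>s"
    unfolding vec_ac_dens_def
    by (rule someI_ex[of "\<lambda>w. \<exists>\<nu>s. vec_lebesgue_decomp _ w \<nu>s"]) (use vec_lebesgue_decomp_density[OF w] in blast)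
  then show ?thesis
    using vec_lebesgue_decomp_density_unique(1)[OF w] by blast
qed

lemma vec_sing_part_density:
  assumes w: "integrable lborel w" "\<And>A. A \<in> sets borel \<Longrightarrow> \<nu> A = (LINT x:A|lborel. w x)"
  shows "vec_sing_part \<nu> = (\<lambda>A. 0)"
  unfolding vec_sing_part_def
  by (rule the_equality)
     (use vec_lebesgue_decomp_density[OF w] vec_lebesgue_decomp_density_unique(2)[OF w] in blast)+

text \<open>Where \<open>r = 0\<close> the bound forces \<open>w = 0\<close>, and
  \<open>0 / 0 = 0\<close> on \<open>ennreal\<close> covers a mobility vanishing at 0. Elsewhere
  \<open>m r\<close> is positive and the division is the real one.\<close>

lemma action_density_le:
  assumes m: "mobility m" and "0 \<le> r" "norm w \<le> C * r"
  shows "action_density m r w \<le> ennreal (C\<^sup>2) * ennreal (r\<^sup>2 / m r)"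
proof (cases "r = 0")
  case True
  then show ?thesis using assms by (simp add: action_density_def divide_ennreal_def)
next
  case False
  then have mr: "0 < m r" using mobility_pos[OF m] assms by simp
  have "(norm w)\<^sup>2 \<le> (C * r)\<^sup>2" using assms by (intro power_mono) auto
  then have "(norm w)\<^sup>2 / m r \<le> C\<^sup>2 * (r\<^sup>2 / m r)"
    using mr by (simp add: power_mult_distrib divide_right_mono)
  then show ?thesis
    using assms mr
    by (simp add: action_density_def divide_ennreal ennreal_leI flip: ennreal_mult)
qed

text \<open>Both singular parts vanish, so for either value of the test
  \<open>mob_slope m = 0\<close> the action is the integral of the action density, which is bounded
  pointwise.\<close>

lemma action_le_nn_integral:
  fixes \<rho> :: "'a::euclidean_space \<Rightarrow> real"
  assumes m: "mobility m"
    and \<mu>: "\<mu> = density lborel (\<lambda>x. ennreal (\<rho> x))" "emeasure \<mu> (- closure \<Omega>) = 0"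
    and \<rho>: "integrable lborel \<rho>" "\<And>x. 0 \<le> \<rho> x"
    and \<nu>: "total_variation \<nu> (- closure \<Omega>) = 0"
    and w: "integrable lborel w" "\<And>A. A \<in> sets borel \<Longrightarrow> \<nu> A = (LINT x:A|lborel. w x)"
    and le: "AE x in lborel. norm (w x) \<le> C * \<rho> x"
  shows "action m \<Omega> \<mu> \<nu> \<le> ennreal (C\<^sup>2) * (\<integral>\<^sup>+x. ennreal ((\<rho> x)\<^sup>2 / m (\<rho> x)) \<partial>lborel)"
proof -
  have [measurable]: "\<rho> \<in> borel_measurable borel" using \<rho> by auto
  have [measurable]: "(\<lambda>x. m (\<rho> x)) \<in> borel_measurable borel"
    by (rule borel_measurable_mobility[OF m _ \<rho>(2)]) simp
  have sing: "sing_part \<mu> = null_measure borel" "vec_sing_part \<nu> = (\<lambda>A. 0)"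
    using sing_part_density[OF \<rho>] vec_sing_part_density[OF w] \<mu> by auto
  have w_ae: "AE x in lborel. vec_ac_dens \<nu> x = w x"
    by (rule vec_ac_dens_density[OF w])
  \<comment> \<open>A witness for the branch \<open>mob_slope m \<noteq> 0\<close>. Whichever
    density the choice operator picks there, its integral against the null measure is 0.\<close>
  have "vec_density (\<lambda>A. 0) (null_measure borel :: 'a measure) (\<lambda>x. 0)"
    by (simp add: vec_density_def)
  then have "action m \<Omega> \<mu> \<nu>
      = (\<integral>\<^sup>+x\<in>\<Omega>. action_density m (ac_dens \<mu> x) (vec_ac_dens \<nu> x) \<partial>lborel)"
    unfolding action_def Let_def sing using \<mu> \<nu>
    by (auto simp: nn_integral_null_measure)
  also have "\<dots> \<le> (\<integral>\<^sup>+x. ennreal (C\<^sup>2) * ennreal ((\<rho> x)\<^sup>2 / m (\<rho> x)) \<partial>lborel)"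
  proof (rule nn_integral_mono_AE)
    show "AE x in lborel. action_density m (ac_dens \<mu> x) (vec_ac_dens \<nu> x) * indicator \<Omega> x
        \<le> ennreal (C\<^sup>2) * ennreal ((\<rho> x)\<^sup>2 / m (\<rho> x))"
      using ac_dens_density[OF \<rho>] w_ae le unfolding \<mu>(1)[symmetric]
      by eventually_elim
         (use action_density_le[OF m \<rho>(2)] in \<open>auto simp: indicator_def\<close>)
  qed
  also have "\<dots> = ennreal (C\<^sup>2) * (\<integral>\<^sup>+x. ennreal ((\<rho> x)\<^sup>2 / m (\<rho> x)) \<partial>lborel)"
    by (rule nn_integral_cmult) measurable
  finally show ?thesis .
qed

text \<open>The set where \<open>g\<close> is nonnegative is a Hahn set and attains the supremum.
  The embedding \<open>ennreal\<close> truncates \<open>g\<close> to its positive part.\<close>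

lemma pos_part_density:
  fixes M :: "'a::euclidean_space measure"
  assumes s[measurable_cong]: "sets M = sets borel" and g: "integrable M g"
    and \<nu>: "\<And>B. B \<in> sets borel \<Longrightarrow> \<nu> B \<bullet> b = (LINT x:B|M. g x)"
  shows "pos_part \<nu> b = density M (\<lambda>x. ennreal (g x))"
proof -
  have sp: "space M = UNIV" using sets_eq_imp_space_eq[OF s] by simp
  have [measurable]: "g \<in> borel_measurable M" using g by auto
  have "(SUP B \<in> {B \<in> sets borel. B \<subseteq> A}. ennreal (\<nu> B \<bullet> b)) = emeasure (density M (\<lambda>x. ennreal (g x))) A"
    if A: "A \<in> sets borel" for A
  proof (rule antisym)
    have A'[measurable]: "A \<in> sets M" using A s by simp
    have em: "emeasure (density M (\<lambda>x. ennreal (g x))) A = (\<integral>\<^sup>+x\<in>A. ennreal (g x) \<partial>M)"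
      by (rule emeasure_density) auto
    show "(SUP B \<in> {B \<in> sets borel. B \<subseteq> A}. ennreal (\<nu> B \<bullet> b)) \<le> emeasure (density M (\<lambda>x. ennreal (g x))) A"
    proof (rule SUP_least)
      fix B assume "B \<in> {B \<in> sets borel. B \<subseteq> A}"
      then have B: "B \<in> sets borel" "B \<subseteq> A" by auto
      have B'[measurable]: "B \<in> sets M" using B s by simp
      have int: "integrable M (\<lambda>x. indicator B x *\<^sub>R g x)"
        using g by (rule integrable_mult_indicator[rotated]) simp
      \<comment> \<open>Replacing the integrand by its positive part discards the negative
        contributions; enlarging \<open>B\<close> to \<open>A\<close> is then harmless.\<close>
      have "\<nu> B \<bullet> b \<le> (LINT x|M. max 0 (indicator B x *\<^sub>R g x))"
        unfolding \<nu>[OF B(1)] set_lebesgue_integral_def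
        by (intro integral_mono int integrable_max) auto
      then have "ennreal (\<nu> B \<bullet> b) \<le> ennreal (LINT x|M. max 0 (indicator B x *\<^sub>R g x))"
        by (rule ennreal_leI)
      also have "\<dots> = (\<integral>\<^sup>+x. ennreal (max 0 (indicator B x *\<^sub>R g x)) \<partial>M)"
        by (intro nn_integral_eq_integral[symmetric] integrable_max int) auto
      also have "\<dots> \<le> (\<integral>\<^sup>+x\<in>A. ennreal (g x) \<partial>M)"
        using B by (intro nn_integral_mono) (auto simp: indicator_def max_def ennreal_leI)
      finally show "ennreal (\<nu> B \<bullet> b) \<le> emeasure (density M (\<lambda>x. ennreal (g x))) A"
        by (simp add: em)
    qed
    let ?B = "{x \<in> A. 0 \<le> g x}"
    have "?B = {x \<in> space M. x \<in> A \<and> 0 \<le> g x}" by (auto simp: sp)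
    also have "\<dots> \<in> sets M" by measurable
    finally have B'[measurable]: "?B \<in> sets M" .
    then have B: "?B \<in> sets borel" by (simp add: s)
    have "(\<integral>\<^sup>+x\<in>A. ennreal (g x) \<partial>M) = (\<integral>\<^sup>+x. ennreal (indicator ?B x *\<^sub>R g x) \<partial>M)"
      by (intro nn_integral_cong) (auto simp: indicator_def ennreal_neg)
    also have "\<dots> = ennreal (LINT x|M. indicator ?B x *\<^sub>R g x)"
      by (intro nn_integral_eq_integral integrable_mult_indicator g B') (auto simp: indicator_def)
    also have "\<dots> = ennreal (\<nu> ?B \<bullet> b)"
      using \<nu>[OF B] by (simp add: set_lebesgue_integral_def)
    also have "\<dots> \<le> (SUP B \<in> {B \<in> sets borel. B \<subseteq> A}. ennreal (\<nu> B \<bullet> b))"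
      by (rule SUP_upper) (use B in auto)
    finally show "emeasure (density M (\<lambda>x. ennreal (g x))) A \<le> (SUP B \<in> {B \<in> sets borel. B \<subseteq> A}. ennreal (\<nu> B \<bullet> b))"
      by (simp add: em)
  qed
  then have "pos_part \<nu> b = measure_of UNIV (sets borel) (emeasure (density M (\<lambda>x. ennreal (g x))))"
    unfolding pos_part_def using sets.sigma_sets_eq[of "borel :: 'a measure"]
    by (intro measure_of_eq) auto
  also have "\<dots> = density M (\<lambda>x. ennreal (g x))"
    using measure_of_of_measure[of "density M (\<lambda>x. ennreal (g x))"] by (simp add: s sp)
  finally show ?thesis .
qed

text \<open>In each coordinate the two Hahn-Jordan parts have the densities
  \<open>max 0 (g x \<bullet> b)\<close> and \<open>max 0 (g x \<bullet> - b)\<close>, whose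
  difference is \<open>g x \<bullet> b\<close>. The bounds on \<open>g\<close> and \<open>F\<close>
  ensure integrability.\<close>

lemma vector_integral_density:
  fixes M :: "'a::euclidean_space measure" and g F :: "'a \<Rightarrow> 'a"
  assumes fin: "finite_measure M" and s[measurable_cong]: "sets M = sets borel"
    and g[measurable]: "g \<in> borel_measurable borel" and gK: "\<And>x. norm (g x) \<le> K"
    and \<nu>: "\<And>B. B \<in> sets borel \<Longrightarrow> \<nu> B = (LINT x:B|M. g x)"
    and F[measurable]: "F \<in> borel_measurable borel" and FL: "\<And>x. norm (F x) \<le> L"
  shows "vector_integral \<nu> F = (LINT x|M. F x \<bullet> g x)"
proof -
  interpret finite_measure M by fact
  have L: "0 \<le> L" using FL[of undefined] norm_ge_zero order_trans by blast
  have gint: "integrable M g"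
    by (rule integrable_const_bound[where B = K]) (use gK in auto)
  have ind: "integrable M (\<lambda>x. indicator B x *\<^sub>R g x)" if "B \<in> sets borel" for B
    by (rule integrable_mult_indicator[OF _ gint]) (use that s in simp)
  have pp: "pos_part \<nu> b = density M (\<lambda>x. ennreal (max 0 (g x \<bullet> b)))" for b
  proof -
    have "pos_part \<nu> b = density M (\<lambda>x. ennreal (g x \<bullet> b))"
      using ind by (intro pos_part_density s integrable_inner_left gint)
        (simp add: \<nu> set_lebesgue_integral_def flip: integral_inner_left)
    also have "(\<lambda>x. ennreal (g x \<bullet> b)) = (\<lambda>x. ennreal (max 0 (g x \<bullet> b)))"
      by (auto simp: max_def ennreal_neg)
    finally show ?thesis .
  qed
  have bnd: "\<bar>(F x \<bullet> b) * (g x \<bullet> b)\<bar> \<le> L * K" if "b \<in> Basis" for x b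
    unfolding abs_mult
    using Basis_le_norm[OF that, of "F x"] Basis_le_norm[OF that, of "g x"] FL[of x] gK[of x] L
    by (intro mult_mono) auto
  have int: "integrable M (\<lambda>x. (F x \<bullet> b) * (g x \<bullet> b))" if "b \<in> Basis" for b
    by (rule integrable_const_bound[where B = "L * K"]) (use bnd[OF that] in auto)
  have int': "integrable M (\<lambda>x. max 0 (g x \<bullet> c) * (F x \<bullet> b))"
    if "b \<in> Basis" "c = b \<or> c = - b" for b c
  proof (rule Bochner_Integration.integrable_bound[OF int[OF that(1)]])
    have "\<bar>max 0 (g x \<bullet> c)\<bar> \<le> \<bar>g x \<bullet> b\<bar>" for x
      using that(2) by (auto simp: max_def)
    then show "AE x in M. norm (max 0 (g x \<bullet> c) * (F x \<bullet> b)) \<le> norm ((F x \<bullet> b) * (g x \<bullet> b))"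
      by (intro AE_I2) (simp add: abs_mult mult.commute mult_left_mono)
  qed measurable
  have "(\<integral>x. F x \<bullet> b \<partial>pos_part \<nu> b) - (\<integral>x. F x \<bullet> b \<partial>pos_part \<nu> (- b))
      = (LINT x|M. (F x \<bullet> b) * (g x \<bullet> b))" if b: "b \<in> Basis" for b
  proof -
    have "(\<integral>x. F x \<bullet> b \<partial>pos_part \<nu> b) - (\<integral>x. F x \<bullet> b \<partial>pos_part \<nu> (- b))
        = (LINT x|M. max 0 (g x \<bullet> b) * (F x \<bullet> b)) - (LINT x|M. max 0 (g x \<bullet> - b) * (F x \<bullet> b))"
      unfolding pp by (subst (1 2) integral_density) auto
    also have "\<dots> = (LINT x|M. max 0 (g x \<bullet> b) * (F x \<bullet> b) - max 0 (g x \<bullet> - b) * (F x \<bullet> b))"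
      using b by (intro Bochner_Integration.integral_diff[symmetric] int') auto
    also have "\<dots> = (LINT x|M. (F x \<bullet> b) * (g x \<bullet> b))"
      by (intro Bochner_Integration.integral_cong) (auto simp: max_def)
    finally show ?thesis .
  qed
  then have "vector_integral \<nu> F = (\<Sum>b\<in>Basis. (LINT x|M. (F x \<bullet> b) * (g x \<bullet> b)))"
    unfolding vector_integral_def by simp
  also have "\<dots> = (LINT x|M. (\<Sum>b\<in>Basis. (F x \<bullet> b) * (g x \<bullet> b)))"
    using int by (intro Bochner_Integration.integral_sum[symmetric])
  also have "\<dots> = (LINT x|M. F x \<bullet> g x)"
    by (subst euclidean_inner[of "F _"]) simp
  finally show ?thesis .
qed

section \<open>Displacement interpolation of a coupling\<close>

text \<open>\<open>K\<close> may be larger than the support of \<open>f\<close>: derivatives of a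
  test function are controlled on the support of the test function itself.\<close>

lemma bounded_if_compact_support:
  fixes f :: "'b::real_normed_vector \<Rightarrow> real"
  assumes "continuous_on UNIV f" "compact K" "closure {x. f x \<noteq> 0} \<subseteq> K"
  obtains B where "\<And>x. \<bar>f x\<bar> \<le> B"
proof -
  have "compact (f ` K)"
    using continuous_on_subset[OF assms(1)] assms(2) by (intro compact_continuous_image) auto
  then obtain B where B: "\<And>x. x \<in> K \<Longrightarrow> \<bar>f x\<bar> \<le> B"
    using compact_imp_bounded bounded_iff by (metis imageI real_norm_def)
  have "\<bar>f x\<bar> \<le> max 0 B" for x
  proof (cases "x \<in> K")
    case True
    then show ?thesis using B[of x] by linarith
  next
    case False
    then have "x \<notin> {x. f x \<noteq> 0}" using assms(3) closure_subset by (meson subsetD)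
    then have "f x = 0" by simp
    then show ?thesis by simp
  qed
  then show thesis by (rule that)
qed

text \<open>Off its closed support, \<open>f\<close> coincides with 0 on an open set.\<close>

lemma frechet_derivative_outside_support:
  fixes f :: "'b::real_normed_vector \<Rightarrow> real"
  assumes "z \<notin> closure {x. f x \<noteq> 0}"
  shows "frechet_derivative f (at z) = (\<lambda>v. 0)"
proof -
  have "((\<lambda>x. 0) has_derivative (\<lambda>v. 0)) (at z)" by (rule has_derivative_const)
  then have "(f has_derivative (\<lambda>v. 0)) (at z)"
    by (rule has_derivative_transform_within_open[where s = "- closure {x. f x \<noteq> 0}"])
       (use assms closure_subset[of "{x. f x \<noteq> 0}"] in auto)
  then show ?thesis by (rule frechet_derivative_at[symmetric])
qed

lemma test_function_derivative:
  assumes \<phi>: "test_function \<phi>"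
  shows "(\<phi> has_derivative frechet_derivative \<phi> (at z)) (at z)"
    and "continuous_on UNIV (\<lambda>z. frechet_derivative \<phi> (at z) v)"
    and "\<exists>B. \<forall>z. \<bar>frechet_derivative \<phi> (at z) v\<bar> \<le> B"
proof -
  have C1: "C_k (Suc 0) \<phi>" using \<phi> by (simp add: test_function_def del: C_k.simps)
  then show "(\<phi> has_derivative frechet_derivative \<phi> (at z)) (at z)"
    unfolding C_k.simps using frechet_derivative_works by blast
  show cont: "continuous_on UNIV (\<lambda>z. frechet_derivative \<phi> (at z) v)"
    using C1 unfolding C_k.simps by blast
  let ?K = "closure {z. \<phi> z \<noteq> 0}"
  have "{z. frechet_derivative \<phi> (at z) v \<noteq> 0} \<subseteq> ?K"
    using frechet_derivative_outside_support[of _ \<phi>] by fastforce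
  then have "closure {z. frechet_derivative \<phi> (at z) v \<noteq> 0} \<subseteq> ?K"
    by (intro closure_minimal) auto
  moreover have "compact ?K" using \<phi> by (simp add: test_function_def)
  ultimately show "\<exists>B. \<forall>z. \<bar>frechet_derivative \<phi> (at z) v\<bar> \<le> B"
    using bounded_if_compact_support[OF cont, of ?K] by metis
qed

text \<open>Expansion of \<open>v\<close> in the basis and linearity of the derivative. Together
  with \<open>time_deriv\<close> this yields the derivative in the direction
  \<open>(1, v)\<close>.\<close>

lemma space_grad_inner:
  assumes "test_function \<phi>"
  shows "space_grad \<phi> s x \<bullet> v = frechet_derivative \<phi> (at (s, x)) (0, v)"
proof -
  interpret D: linear "frechet_derivative \<phi> (at (s, x))"
    using test_function_derivative(1)[OF assms] has_derivative_linear by blast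
  have "frechet_derivative \<phi> (at (s, x)) (0, v)
      = frechet_derivative \<phi> (at (s, x)) (\<Sum>b\<in>Basis. (v \<bullet> b) *\<^sub>R (0, b))"
    by (simp add: sum_prod euclidean_representation)
  also have "\<dots> = (\<Sum>b\<in>Basis. (v \<bullet> b) * frechet_derivative \<phi> (at (s, x)) (0, b))"
    by (simp only: D.sum D.scale real_scaleR_def)
  also have "\<dots> = space_grad \<phi> s x \<bullet> v"
    by (simp add: space_grad_def inner_sum_left) (simp add: inner_commute mult.commute)
  finally show ?thesis by simp
qed

lemma continuous_on_space_grad:
  assumes "test_function \<phi>"
  shows "continuous_on UNIV (\<lambda>z. space_grad \<phi> (fst z) (snd z))"
  unfolding space_grad_def
  by (intro continuous_intros)
     (use test_function_derivative(2)[OF assms] in simp)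

lemma bounded_space_grad:
  assumes "test_function (\<phi> :: real \<times> 'a::euclidean_space \<Rightarrow> real)"
  obtains L where "\<And>s x. norm (space_grad \<phi> s x) \<le> L"
proof -
  have "\<forall>b. \<exists>B. \<forall>z. \<bar>frechet_derivative \<phi> (at z) (0, b)\<bar> \<le> B"
    using test_function_derivative(3)[OF assms] by blast
  then obtain B where B: "\<And>b z. \<bar>frechet_derivative \<phi> (at z) (0, b)\<bar> \<le> B b"
    by metis
  have "norm (space_grad \<phi> s x) \<le> (\<Sum>b\<in>Basis. B b)" for s x
    unfolding space_grad_def
    by (rule sum_norm_le) (use B in simp)
  then show thesis by (rule that)
qed

text \<open>Over the set \<open>A\<close> where \<open>u\<close> exceeds \<open>C\<close>, the
  nonnegative function \<open>u - C\<close> has integral 0, so \<open>A\<close> is a null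
  set.\<close>

lemma AE_le_const_if_emeasure_density_le:
  assumes fin: "finite_measure M" and u[measurable]: "u \<in> borel_measurable M"
    and le: "\<And>A. A \<in> sets M \<Longrightarrow> emeasure (density M u) A \<le> ennreal C * emeasure M A"
  shows "AE x in M. u x \<le> ennreal C"
proof -
  interpret finite_measure M by fact
  define A where "A = {x \<in> space M. ennreal C < u x}"
  have A[measurable]: "A \<in> sets M" unfolding A_def by measurable
  have mass: "(\<integral>\<^sup>+x. ennreal C * indicator A x \<partial>M) = ennreal C * emeasure M A"
    by (rule nn_integral_cmult_indicator) simp
  have "ennreal C * emeasure M A < \<infinity>"
    by (simp add: ennreal_mult_eq_top_iff less_top[symmetric])
  \<comment> \<open>On \<open>ennreal\<close>, \<open>a - b = 0\<close> requires \<open>a\<close> to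
    be finite in addition to \<open>a \<le> b\<close>, since \<open>top - top = top\<close>.\<close>
  then have fin_A: "(\<integral>\<^sup>+x. u x * indicator A x \<partial>M) < \<infinity>"
    using le[OF A] by (simp add: emeasure_density)
  have "(\<integral>\<^sup>+x. u x * indicator A x - ennreal C * indicator A x \<partial>M)
      = (\<integral>\<^sup>+x. u x * indicator A x \<partial>M) - (\<integral>\<^sup>+x. ennreal C * indicator A x \<partial>M)"
    by (rule nn_integral_diff)
       (use mass in \<open>auto simp: A_def indicator_def ennreal_mult_eq_top_iff intro!: AE_I2\<close>)
  also have "\<dots> = 0"
    using fin_A le[OF A] by (simp add: mass emeasure_density diff_eq_0_iff_ennreal)
  finally have "AE x in M. u x * indicator A x - ennreal C * indicator A x = 0"
    by (subst (asm) nn_integral_0_iff_AE) auto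
  with AE_space show ?thesis
  proof eventually_elim
    case (elim x)
    show ?case
    proof (rule ccontr)
      assume "\<not> u x \<le> ennreal C"
      then have "x \<in> A" "ennreal C < u x" using elim by (auto simp: A_def)
      then show False using elim diff_gt_0_iff_gt_ennreal[of "u x" "ennreal C"] by simp
    qed
  qed
qed

text \<open>This is the conditional expectation of \<open>f\<close> given \<open>T\<close>, as a function of the value of \<open>T\<close>.\<close>

lemma pushforward_density:
  fixes f :: "'b \<Rightarrow> real" and T :: "'b \<Rightarrow> 'a::euclidean_space"
  assumes fin: "finite_measure \<pi>" and T[measurable]: "T \<in> measurable \<pi> borel"
    and f[measurable]: "f \<in> borel_measurable \<pi>" and fK: "\<And>p. \<bar>f p\<bar> \<le> K"
  shows "\<exists>g. g \<in> borel_measurable borel \<and> (\<forall>z. \<bar>g z\<bar> \<le> K) \<and>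
    (\<forall>h B. h \<in> borel_measurable borel \<longrightarrow> (\<forall>z. \<bar>h z\<bar> \<le> B) \<longrightarrow>
      (LINT z|distr \<pi> borel T. h z * g z) = (LINT p|\<pi>. h (T p) * f p))"
proof -
  interpret finite_measure \<pi> by fact
  define M where "M = distr \<pi> borel T"
  have sM[measurable_cong]: "sets M = sets borel" by (simp add: M_def)
  have finM: "finite_measure M" unfolding M_def by (rule finite_measure_distr) measurable
  interpret M: finite_measure M by (rule finM)
  have K0: "0 \<le> K" using fK[of undefined] by linarith
  \<comment> \<open>Adding \<open>K\<close> makes the integrand nonnegative, so its image is a
    positive measure to which Radon-Nikodym applies; the shift is undone in
    \<open>g\<close>.\<close>
  define N where "N = distr (density \<pi> (\<lambda>p. ennreal (f p + K))) borel T"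
  have f0: "0 \<le> f p + K" for p using fK[of p] by linarith
  have Nle: "emeasure N A \<le> ennreal (2 * K) * emeasure M A" if "A \<in> sets M" for A
  proof -
    have A[measurable]: "A \<in> sets borel" using that sM by simp
    have "emeasure N A = (\<integral>\<^sup>+z. indicator A z \<partial>N)"
      by (rule nn_integral_indicator[symmetric]) (simp add: N_def)
    also have "\<dots> = (\<integral>\<^sup>+p. ennreal (f p + K) * indicator A (T p) \<partial>\<pi>)"
      unfolding N_def by (subst nn_integral_distr) (auto simp: nn_integral_density)
    also have "\<dots> \<le> (\<integral>\<^sup>+p. ennreal (2 * K) * indicator A (T p) \<partial>\<pi>)"
      using fK by (intro nn_integral_mono mult_right_mono ennreal_leI) (auto simp: abs_le_iff)
    also have "\<dots> = ennreal (2 * K) * (\<integral>\<^sup>+z. indicator A z \<partial>M)"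
      unfolding M_def by (subst nn_integral_distr) (auto simp: nn_integral_cmult)
    finally show ?thesis using sM by simp
  qed
  have "absolutely_continuous M N"
    unfolding absolutely_continuous_def
  proof
    fix A assume "A \<in> null_sets M"
    then have "A \<in> sets M" "emeasure M A = 0" by auto
    then have "emeasure N A = 0" using Nle[of A] by simp
    then show "A \<in> null_sets N" using \<open>A \<in> sets M\<close> sM by (auto simp: N_def)
  qed
  moreover have "sets N = sets M" by (simp add: N_def sM)
  ultimately obtain u where u: "u \<in> borel_measurable M" "density M u = N"
    using M.Radon_Nikodym by blast
  have uK: "AE z in M. u z \<le> ennreal (2 * K)"
    by (rule AE_le_const_if_emeasure_density_le[OF finM u(1)]) (use u Nle in simp)
  \<comment> \<open>The truncation at \<open>2 * K\<close> makes the bound on \<open>g\<close> hold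
    everywhere and changes \<open>g\<close> only on a null set. Where \<open>u\<close> is infinite,
    \<open>enn2real\<close> returns 0.\<close>
  define g where "g = (\<lambda>z. min (enn2real (u z)) (2 * K) - K)"
  have u'[measurable]: "u \<in> borel_measurable borel" using u sM measurable_cong_sets by blast
  have g[measurable]: "g \<in> borel_measurable borel" unfolding g_def by measurable
  have gK: "\<bar>g z\<bar> \<le> K" for z
    using K0 enn2real_nonneg[of "u z"] unfolding g_def by (auto simp: abs_le_iff min_def)
  have g0: "0 \<le> g z + K" for z using gK[of z] by linarith
  have "AE z in M. u z = ennreal (g z + K)"
    using uK
  proof eventually_elim
    case (elim z)
    then have "u z < top" by (rule order.strict_trans1) simp
    moreover have "enn2real (u z) \<le> 2 * K" using elim K0 by (simp add: enn2real_leI)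
    ultimately show ?case by (simp add: g_def min_absorb1)
  qed
  then have N: "N = density M (\<lambda>z. ennreal (g z + K))"
    using u by (subst u(2)[symmetric], intro density_cong) auto
  have "(LINT z|M. h z * g z) = (LINT p|\<pi>. h (T p) * f p)"
    if h[measurable]: "h \<in> borel_measurable borel" and hB: "\<And>z. \<bar>h z\<bar> \<le> B" for h B
  proof -
    have B0: "0 \<le> B" using hB[of undefined] by linarith
    have bnd: "\<bar>h z * g y\<bar> \<le> B * K" "\<bar>h z * f p\<bar> \<le> B * K" for z y p
      using hB[of z] gK[of y] fK[of p] B0 by (auto simp: abs_mult intro!: mult_mono)
    have i1: "integrable M (\<lambda>z. h z * g z)"
      by (rule M.integrable_const_bound[where B = "B * K"]) (use bnd in auto)
    have i2: "integrable M h"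
      by (rule M.integrable_const_bound[where B = B]) (use hB in auto)
    have i3: "integrable \<pi> (\<lambda>p. h (T p) * f p)"
      by (rule integrable_const_bound[where B = "B * K"]) (use bnd in auto)
    have i4: "integrable \<pi> (\<lambda>p. h (T p))"
      by (rule integrable_const_bound[where B = B]) (use hB in auto)
    \<comment> \<open>The identity is proved for the shifted functions; the extra terms,
      \<open>K\<close> times the integrals of \<open>h\<close> and of \<open>h\<close> composed with
      \<open>T\<close>, agree and cancel.\<close>
    have "(LINT z|M. h z * g z) + K * (LINT z|M. h z) = (LINT z|M. h z * g z + K * h z)"
      using i1 i2 by simp
    also have "\<dots> = (LINT z|M. (g z + K) * h z)"
      by (simp add: algebra_simps)
    also have "\<dots> = (LINT z|N. h z)"
      unfolding N using g0 by (subst integral_density) auto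
    also have "\<dots> = (LINT p|\<pi>. (f p + K) * h (T p))"
      unfolding N_def using f0 by (subst integral_distr) (auto simp: integral_density)
    also have "\<dots> = (LINT p|\<pi>. h (T p) * f p + K * h (T p))"
      by (simp add: algebra_simps)
    also have "\<dots> = (LINT p|\<pi>. h (T p) * f p) + K * (LINT p|\<pi>. h (T p))"
      using i3 i4 by simp
    also have "(LINT p|\<pi>. h (T p)) = (LINT z|M. h z)"
      unfolding M_def by (rule integral_distr[symmetric]) auto
    finally show ?thesis by simp
  qed
  with g gK show ?thesis unfolding M_def by (intro exI[of _ g] conjI allI impI) blast+
qed

section \<open>The interpolating curve and its momentum\<close>

locale displacement_interpolation = finite_measure \<pi>
  for \<pi> :: "('a::euclidean_space \<times> 'a) measure" +
  fixes \<Omega> :: "'a set"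
  assumes sets_\<pi>[measurable_cong]: "sets \<pi> = sets (borel \<Otimes>\<^sub>M borel)"
    and \<Omega>[measurable]: "\<Omega> \<in> sets borel" and bounded_\<Omega>: "bounded \<Omega>" and convex_\<Omega>: "convex \<Omega>"
    and AE_\<pi>: "AE p in \<pi>. p \<in> \<Omega> \<times> \<Omega>"
begin

definition T :: "real \<Rightarrow> 'a \<times> 'a \<Rightarrow> 'a" where
  "T s p = (1 - s) *\<^sub>R fst p + s *\<^sub>R snd p"

text \<open>The displacement, cut off outside \<open>\<Omega> \<times> \<Omega>\<close>: this alters
  it only on a \<open>\<pi>\<close>-null set and makes it bounded by the diameter at every
  point.\<close>

definition V :: "'a \<times> 'a \<Rightarrow> 'a" where
  "V p = indicator (\<Omega> \<times> \<Omega>) p *\<^sub>R (snd p - fst p)"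

definition \<mu> :: "real \<Rightarrow> 'a measure" where
  "\<mu> s = distr \<pi> borel (T s)"

text \<open>The image under \<open>T s\<close> of the vector measure with density \<open>V\<close>
  with respect to \<open>\<pi>\<close>. The value 0 off the Borel sets is the convention of
  \<open>vector_measure\<close>.\<close>

definition \<nu> :: "real \<Rightarrow> 'a set \<Rightarrow> 'a" where
  "\<nu> s B = (if B \<in> sets borel then LINT p|\<pi>. indicator B (T s p) *\<^sub>R V p else 0)"

abbreviation K :: real where "K \<equiv> diameter \<Omega>"

text \<open>Time is a measurable function here, which gives the joint measurability in time and pair
  that Fubini requires.\<close>

lemma T_measurable[measurable (raw)]:
  assumes [measurable]: "f \<in> borel_measurable M" "g \<in> measurable M (borel \<Otimes>\<^sub>M borel)"
  shows "(\<lambda>x. T (f x) (g x)) \<in> borel_measurable M"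
  unfolding T_def by measurable

lemma V_measurable[measurable]: "V \<in> borel_measurable (borel \<Otimes>\<^sub>M borel)"
  unfolding V_def by measurable

lemma V_measurable_\<pi>[measurable]: "V \<in> borel_measurable \<pi>"
  using V_measurable measurable_cong_sets[OF sets_\<pi> refl] by blast

lemma K_nonneg: "0 \<le> K"
  by (rule diameter_ge_0[OF bounded_\<Omega>])

lemma norm_V: "norm (V p) \<le> K"
  using diameter_bounded_bound[OF bounded_\<Omega>, of "snd p" "fst p"] K_nonneg
  by (auto simp: V_def indicator_def dist_norm)

text \<open>Convexity keeps the segments inside \<open>\<Omega>\<close>.\<close>

lemma T_in: "p \<in> \<Omega> \<times> \<Omega> \<Longrightarrow> s \<in> {0..1} \<Longrightarrow> T s p \<in> \<Omega>"
  using convex_\<Omega> by (auto simp: T_def convex_alt)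

lemma sets_\<mu>[measurable_cong, simp]: "sets (\<mu> s) = sets borel"
  by (simp add: \<mu>_def)

lemma finite_\<mu>: "finite_measure (\<mu> s)"
  unfolding \<mu>_def by (rule finite_measure_distr) measurable

lemma space_\<pi>: "space \<pi> = UNIV"
  using sets_eq_imp_space_eq[OF sets_\<pi>] by (simp add: space_pair_measure)

lemma emeasure_\<mu>: "B \<in> sets borel \<Longrightarrow> emeasure (\<mu> s) B = emeasure \<pi> (T s -` B)"
  by (simp add: \<mu>_def emeasure_distr space_\<pi>)

lemma emeasure_\<mu>_UNIV: "emeasure (\<mu> s) UNIV = emeasure \<pi> UNIV"
  by (simp add: emeasure_\<mu>)

lemma \<mu>_outside: "s \<in> {0..1} \<Longrightarrow> emeasure (\<mu> s) (- closure \<Omega>) = 0"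
proof -
  assume s: "s \<in> {0..1}"
  have "emeasure \<pi> (T s -` (- closure \<Omega>)) = emeasure \<pi> {p \<in> space \<pi>. T s p \<notin> closure \<Omega>}"
    by (simp add: space_\<pi> vimage_def)
  also have "\<dots> = 0"
    by (rule emeasure_eq_0_AE)
       (use AE_\<pi> in eventually_elim, use T_in[OF _ s] closure_subset in blast)
  finally show ?thesis by (simp add: emeasure_\<mu>)
qed

lemma \<mu>_pos_measures: "s \<in> {0..1} \<Longrightarrow> \<mu> s \<in> pos_measures (closure \<Omega>)"
  using finite_\<mu> \<mu>_outside by (auto simp: pos_measures_def)

text \<open>The boundedness of \<open>\<Omega>\<close> enters through \<open>norm_V\<close>. This
  domination controls the total variation and makes \<open>\<nu> s\<close> vanish wherever
  \<open>\<mu> s\<close> does.\<close>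

lemma norm_\<nu>_le: "B \<in> sets borel \<Longrightarrow> ennreal (norm (\<nu> s B)) \<le> ennreal K * emeasure (\<mu> s) B"
proof -
  assume B[measurable]: "B \<in> sets borel"
  have "ennreal (norm (\<nu> s B)) \<le> (\<integral>\<^sup>+p. ennreal (norm (indicator B (T s p) *\<^sub>R V p)) \<partial>\<pi>)"
    unfolding \<nu>_def using B
    by (simp del: norm_scaleR, intro integral_norm_bound_ennreal integrable_const_bound[where B = K])
       (use norm_V K_nonneg in \<open>auto simp: indicator_def\<close>)
  also have "\<dots> \<le> (\<integral>\<^sup>+p. ennreal K * indicator B (T s p) \<partial>\<pi>)"
    using norm_V by (intro nn_integral_mono) (auto simp: indicator_def ennreal_leI)
  also have "\<dots> = ennreal K * (\<integral>\<^sup>+z. indicator B z \<partial>\<mu> s)"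
    unfolding \<mu>_def by (subst nn_integral_distr) (auto simp: nn_integral_cmult)
  finally show ?thesis by simp
qed

lemma total_variation_\<nu>: "total_variation (\<nu> s) A \<le> ennreal K * emeasure (\<mu> s) A"
  by (rule total_variation_le) (use norm_\<nu>_le in auto)

text \<open>Dominated convergence with the constant \<open>K\<close>: by disjointness, partial sums
  of the indicators never exceed 1.\<close>

lemma \<nu>_sums:
  fixes A :: "nat \<Rightarrow> 'a set"
  assumes A: "range A \<subseteq> sets borel" "disjoint_family A"
  shows "(\<lambda>i. \<nu> s (A i)) sums \<nu> s (\<Union>i. A i)"
proof -
  have [measurable]: "A i \<in> sets borel" for i using A by auto
  have ind: "(\<lambda>i. indicator (A i) z :: real) sums indicator (\<Union>i. A i) z" for z
    using A(2) by (intro indicator_sums) (auto simp: disjoint_family_on_def)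
  have le1: "(\<Sum>i<n. indicator (A i) z) \<le> (1::real)" for n z
  proof -
    have "(\<Sum>i<n. indicator (A i) z) \<le> (indicator (\<Union>i. A i) z :: real)"
      using sum_le_suminf[OF sums_summable[OF ind], of "{..<n}" z] sums_unique[OF ind, of z]
      by (simp add: indicator_def)
    also have "\<dots> \<le> 1" by (simp add: indicator_def)
    finally show ?thesis .
  qed
  have int: "integrable \<pi> (\<lambda>p. indicator (A i) (T s p) *\<^sub>R V p)" for i
    by (rule integrable_const_bound[where B = K])
       (use norm_V K_nonneg in \<open>auto simp: indicator_def\<close>)
  have "(\<lambda>n. LINT p|\<pi>. (\<Sum>i<n. indicator (A i) (T s p) *\<^sub>R V p))
      \<longlonglongrightarrow> (LINT p|\<pi>. indicator (\<Union>i. A i) (T s p) *\<^sub>R V p)"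
  proof (rule integral_dominated_convergence[where w = "\<lambda>_. K"])
    show "AE p in \<pi>. (\<lambda>n. \<Sum>i<n. indicator (A i) (T s p) *\<^sub>R V p)
        \<longlonglongrightarrow> indicator (\<Union>i. A i) (T s p) *\<^sub>R V p"
      using sums_scaleR_left[OF ind] by (auto simp: sums_def)
    show "AE p in \<pi>. norm (\<Sum>i<n. indicator (A i) (T s p) *\<^sub>R V p) \<le> K" for n
    proof (rule AE_I2)
      fix p
      have "norm (\<Sum>i<n. indicator (A i) (T s p) *\<^sub>R V p)
          = (\<Sum>i<n. indicator (A i) (T s p)) * norm (V p)"
        by (simp flip: scaleR_sum_left add: abs_of_nonneg sum_nonneg)
      also have "\<dots> \<le> 1 * K"
        using norm_V K_nonneg le1 by (intro mult_mono) auto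
      finally show "norm (\<Sum>i<n. indicator (A i) (T s p) *\<^sub>R V p) \<le> K" by simp
    qed
    show "(\<lambda>p. \<Sum>i<n. indicator (A i) (T s p) *\<^sub>R V p) \<in> borel_measurable \<pi>" for n
      by measurable
    have [measurable]: "(\<Union>i. A i) \<in> sets borel" by measurable
    show "(\<lambda>p. indicator (\<Union>i. A i) (T s p) *\<^sub>R V p) \<in> borel_measurable \<pi>"
      by measurable
  qed simp
  moreover have "(LINT p|\<pi>. (\<Sum>i<n. indicator (A i) (T s p) *\<^sub>R V p)) = (\<Sum>i<n. \<nu> s (A i))" for n
    unfolding \<nu>_def using int by (subst Bochner_Integration.integral_sum) auto
  ultimately show ?thesis by (simp add: sums_def \<nu>_def)
qed

lemma \<nu>_vector_measures: "s \<in> {0..1} \<Longrightarrow> \<nu> s \<in> vector_measures (closure \<Omega>)"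
proof -
  assume s: "s \<in> {0..1}"
  have "total_variation (\<nu> s) UNIV < \<infinity>"
    using total_variation_\<nu>[of s UNIV] finite_measure.emeasure_finite[OF finite_\<mu>, of s UNIV]
    by (auto simp: less_top[symmetric] ennreal_mult_eq_top_iff top_unique)
  moreover have "total_variation (\<nu> s) (- closure \<Omega>) = 0"
    using total_variation_\<nu>[of s "- closure \<Omega>"] \<mu>_outside[OF s] by simp
  moreover have "\<nu> s A = 0" if "A \<notin> sets borel" for A
    using that by (simp add: \<nu>_def)
  ultimately show ?thesis
    using \<nu>_sums by (simp add: vector_measures_def vector_measure_def)
qed

text \<open>Each segment is continuous in time and the test function is bounded, so dominated
  convergence applies along sequences of times.\<close>

lemma \<mu>_weak_star_continuous: "weak_star_continuous \<mu>"
  unfolding weak_star_continuous_def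
proof (intro allI impI)
  fix f :: "'a \<Rightarrow> real"
  assume f: "continuous_on UNIV f" "compact (closure {x. f x \<noteq> 0})"
  obtain B where B: "\<And>x. \<bar>f x\<bar> \<le> B"
    using bounded_if_compact_support[OF f order_refl] by blast
  have [measurable]: "f \<in> borel_measurable borel"
    using f(1) by (rule borel_measurable_continuous_onI)
  have "(\<lambda>n. LINT p|\<pi>. f (T (x n) p)) \<longlonglongrightarrow> (LINT p|\<pi>. f (T a p))" if "x \<longlonglongrightarrow> a" for x a
  proof (rule integral_dominated_convergence[where w = "\<lambda>_. B"])
    show "AE p in \<pi>. (\<lambda>n. f (T (x n) p)) \<longlonglongrightarrow> f (T a p)"
    proof (rule AE_I2)
      fix p
      have "(\<lambda>n. T (x n) p) \<longlonglongrightarrow> T a p" unfolding T_def by (intro tendsto_intros that)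
      then show "(\<lambda>n. f (T (x n) p)) \<longlonglongrightarrow> f (T a p)"
        using f(1) by (auto intro: continuous_on_tendsto_compose)
    qed
  qed (use B in auto)
  then have "continuous_on {0..1} (\<lambda>s. LINT p|\<pi>. f (T s p))"
    by (auto simp: continuous_on_sequentially o_def)
  moreover have "(\<integral>x. f x \<partial>\<mu> s) = (LINT p|\<pi>. f (T s p))" for s
    unfolding \<mu>_def by (rule integral_distr) auto
  ultimately show "continuous_on {0..1} (\<lambda>s. \<integral>x. f x \<partial>\<mu> s)" by simp
qed

lemma \<nu>_measurable: "B \<in> sets borel \<Longrightarrow> (\<lambda>s. \<nu> s B) \<in> borel_measurable borel"
proof -
  assume B[measurable]: "B \<in> sets borel"
  have "(\<lambda>s. LINT p|\<pi>. indicator B (T s p) *\<^sub>R V p) \<in> borel_measurable borel"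
    by (rule borel_measurable_lebesgue_integral) (simp add: case_prod_beta)
  then show ?thesis using B by (simp add: \<nu>_def)
qed

text \<open>The Eulerian velocity at time \<open>s\<close>: the conditional expectation of
  \<open>V\<close> given the position \<open>T s\<close>, formed coordinate by coordinate. The last
  conclusion transfers integrals over positions back to pairs.\<close>

lemma velocity_field:
  obtains g where "g \<in> borel_measurable borel" "\<And>z. norm (g z) \<le> DIM('a) * K"
    "\<And>B. B \<in> sets borel \<Longrightarrow> \<nu> s B = (LINT z:B|\<mu> s. g z)"
    "\<And>F L. F \<in> borel_measurable borel \<Longrightarrow> (\<And>z. norm (F z) \<le> L) \<Longrightarrow>
      (LINT z|\<mu> s. F z \<bullet> g z) = (LINT p|\<pi>. F (T s p) \<bullet> V p)"
proof -
  have "\<exists>g. g \<in> borel_measurable borel \<and> (\<forall>z. \<bar>g z\<bar> \<le> K) \<and>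
      (\<forall>h B. h \<in> borel_measurable borel \<longrightarrow> (\<forall>z. \<bar>h z\<bar> \<le> B) \<longrightarrow>
        (LINT z|\<mu> s. h z * g z) = (LINT p|\<pi>. h (T s p) * (V p \<bullet> b)))" if "b \<in> Basis" for b
  proof -
    have Vb: "\<bar>V p \<bullet> b\<bar> \<le> K" for p
      using Basis_le_norm[OF that, of "V p"] norm_V[of p] by linarith
    have "T s \<in> borel_measurable \<pi>" "(\<lambda>p. V p \<bullet> b) \<in> borel_measurable \<pi>"
      by measurable
    from pushforward_density[OF finite_measure_axioms this Vb] show ?thesis
      unfolding \<mu>_def .
  qed
  then have "\<exists>G. \<forall>b\<in>Basis. G b \<in> borel_measurable borel \<and> (\<forall>z. \<bar>G b z\<bar> \<le> K) \<and>
      (\<forall>h B. h \<in> borel_measurable borel \<longrightarrow> (\<forall>z. \<bar>h z\<bar> \<le> B) \<longrightarrow>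
        (LINT z|\<mu> s. h z * G b z) = (LINT p|\<pi>. h (T s p) * (V p \<bullet> b)))"
    by (intro bchoice ballI)
  then obtain G where G_all: "\<forall>b\<in>Basis. G b \<in> borel_measurable borel \<and> (\<forall>z. \<bar>G b z\<bar> \<le> K) \<and>
      (\<forall>h B. h \<in> borel_measurable borel \<longrightarrow> (\<forall>z. \<bar>h z\<bar> \<le> B) \<longrightarrow>
        (LINT z|\<mu> s. h z * G b z) = (LINT p|\<pi>. h (T s p) * (V p \<bullet> b)))" by blast
  then have G[measurable]: "\<And>b. b \<in> Basis \<Longrightarrow> G b \<in> borel_measurable borel"
    and GK: "\<And>b z. b \<in> Basis \<Longrightarrow> \<bar>G b z\<bar> \<le> K"
    by blast+
  have Gh: "(LINT z|\<mu> s. h z * G b z) = (LINT p|\<pi>. h (T s p) * (V p \<bullet> b))"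
    if "b \<in> Basis" "h \<in> borel_measurable borel" "\<And>z. \<bar>h z\<bar> \<le> B" for b h B
    using G_all that by (metis (no_types, lifting))
  interpret M: finite_measure "\<mu> s" by (rule finite_\<mu>)
  define g where "g = (\<lambda>z. \<Sum>b\<in>Basis. G b z *\<^sub>R b)"
  have g[measurable]: "g \<in> borel_measurable borel" unfolding g_def by measurable
  have gb: "g z \<bullet> b = G b z" if "b \<in> Basis" for z b
    using that by (simp add: g_def inner_sum_left_Basis)
  \<comment> \<open>Bounding each coordinate by \<open>K\<close> separately costs the factor
    \<open>DIM('a)\<close>, which is harmless as only a finite constant is wanted.\<close>
  have "norm (g z) \<le> (\<Sum>b\<in>(Basis::'a set). K)" for z
    unfolding g_def by (rule sum_norm_le) (use GK in auto)
  then have gK: "norm (g z) \<le> DIM('a) * K" for z by simp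
  have gint: "integrable (\<mu> s) g"
    by (rule M.integrable_const_bound[where B = "DIM('a) * K"]) (use gK in auto)
  have \<nu>: "\<nu> s B = (LINT z:B|\<mu> s. g z)" if B[measurable]: "B \<in> sets borel" for B
  proof (rule euclidean_eqI)
    fix b :: 'a assume b: "b \<in> Basis"
    have i: "integrable \<pi> (\<lambda>p. indicator B (T s p) *\<^sub>R V p)"
      by (rule integrable_const_bound[where B = K])
         (use norm_V K_nonneg in \<open>auto simp: indicator_def\<close>)
    have j: "integrable (\<mu> s) (\<lambda>z. indicator B z *\<^sub>R g z)"
      by (rule integrable_mult_indicator[OF _ gint]) simp
    have "\<nu> s B \<bullet> b = (LINT p|\<pi>. indicator B (T s p) * (V p \<bullet> b))"
      using B i by (simp add: \<nu>_def flip: integral_inner_left)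
    also have "\<dots> = (LINT z|\<mu> s. indicator B z * G b z)"
      by (rule Gh[OF b, symmetric, where B = 1]) (auto simp: indicator_def)
    also have "\<dots> = (LINT z:B|\<mu> s. g z) \<bullet> b"
      using j by (simp add: set_lebesgue_integral_def gb[OF b] flip: integral_inner_left)
    finally show "\<nu> s B \<bullet> b = (LINT z:B|\<mu> s. g z) \<bullet> b" .
  qed
  have "(LINT z|\<mu> s. F z \<bullet> g z) = (LINT p|\<pi>. F (T s p) \<bullet> V p)"
    if F[measurable]: "F \<in> borel_measurable borel" and FL: "\<And>z. norm (F z) \<le> L" for F L
  proof -
    have Fb: "\<bar>F z \<bullet> b\<bar> \<le> L" if "b \<in> Basis" for z b
      using Basis_le_norm[OF that, of "F z"] FL[of z] by linarith
    have L0: "0 \<le> L" using FL[of undefined] norm_ge_zero order_trans by blast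
    have i: "integrable (\<mu> s) (\<lambda>z. (F z \<bullet> b) * G b z)" if b: "b \<in> Basis" for b
      by (rule M.integrable_const_bound[where B = "L * K"])
         (use b Fb[OF b] GK[OF b] L0 G[OF b] in \<open>auto simp: abs_mult intro!: AE_I2 mult_mono\<close>)
    have Vb: "\<bar>V p \<bullet> b\<bar> \<le> K" if "b \<in> Basis" for p b
      using Basis_le_norm[OF that, of "V p"] norm_V[of p] by linarith
    have j: "integrable \<pi> (\<lambda>p. (F (T s p) \<bullet> b) * (V p \<bullet> b))" if b: "b \<in> Basis" for b
      by (rule integrable_const_bound[where B = "L * K"])
         (use Fb[OF b] Vb[OF b] L0 in \<open>auto simp: abs_mult intro!: AE_I2 mult_mono\<close>)
    have "(LINT z|\<mu> s. F z \<bullet> g z) = (LINT z|\<mu> s. (\<Sum>b\<in>Basis. (F z \<bullet> b) * G b z))"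
      by (subst euclidean_inner) (simp add: gb)
    also have "\<dots> = (\<Sum>b\<in>Basis. (LINT z|\<mu> s. (F z \<bullet> b) * G b z))"
      using i by (rule Bochner_Integration.integral_sum)
    also have "\<dots> = (\<Sum>b\<in>Basis. (LINT p|\<pi>. (F (T s p) \<bullet> b) * (V p \<bullet> b)))"
      using Fb by (intro sum.cong refl Gh[where B = L]) auto
    also have "\<dots> = (LINT p|\<pi>. (\<Sum>b\<in>Basis. (F (T s p) \<bullet> b) * (V p \<bullet> b)))"
      using j by (rule Bochner_Integration.integral_sum[symmetric])
    also have "\<dots> = (LINT p|\<pi>. F (T s p) \<bullet> V p)"
      by (subst (3) euclidean_inner) simp
    finally show ?thesis .
  qed
  with g gK \<nu> show thesis by (rule that)
qed

section \<open>The weak continuity equation\<close>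

lemma vector_integral_\<nu>:
  assumes "F \<in> borel_measurable borel" "\<And>z. norm (F z) \<le> L"
  shows "vector_integral (\<nu> s) F = (LINT p|\<pi>. F (T s p) \<bullet> V p)"
proof -
  obtain g where g: "g \<in> borel_measurable borel" "\<And>z. norm (g z) \<le> DIM('a) * K"
      "\<And>B. B \<in> sets borel \<Longrightarrow> \<nu> s B = (LINT z:B|\<mu> s. g z)"
    and eq: "(LINT z|\<mu> s. F z \<bullet> g z) = (LINT p|\<pi>. F (T s p) \<bullet> V p)"
    by (rule velocity_field[of s]) (use assms in blast)
  show ?thesis
    using vector_integral_density[OF finite_\<mu> sets_\<mu> g assms] eq by simp
qed

text \<open>By Fubini, the weak continuity equation is the integral over \<open>\<pi>\<close> of the fundamental theorem
  of calculus along the segments \<open>s \<mapsto> (s, T s p)\<close>.\<close>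

lemma continuity_equation:
  assumes \<phi>: "test_function \<phi>"
  shows "(LINT s:{0<..<1}|lborel. (\<integral>x. time_deriv \<phi> s x \<partial>\<mu> s)) +
    (LINT s:{0<..<1}|lborel. vector_integral (\<nu> s) (space_grad \<phi> s)) = 0"
proof -
  let ?D = "\<lambda>s x. frechet_derivative \<phi> (at (s, x))"
  let ?I = "{0<..<1::real}"
  interpret LP: pair_sigma_finite lborel \<pi> ..
  obtain B where B: "\<And>s x. \<bar>time_deriv \<phi> s x\<bar> \<le> B"
    unfolding time_deriv_def using test_function_derivative(3)[OF \<phi>] by blast
  obtain L where L: "\<And>s x. norm (space_grad \<phi> s x) \<le> L"
    using bounded_space_grad[OF \<phi>] by blast
  have L0: "0 \<le> L" using L[of undefined undefined] norm_ge_zero order_trans by blast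
  have td: "(\<lambda>z. time_deriv \<phi> (fst z) (snd z)) \<in> borel_measurable (borel \<Otimes>\<^sub>M borel)"
    unfolding borel_prod time_deriv_def
    by (rule borel_measurable_continuous_onI) (use test_function_derivative(2)[OF \<phi>] in simp)
  have sg: "(\<lambda>z. space_grad \<phi> (fst z) (snd z)) \<in> borel_measurable (borel \<Otimes>\<^sub>M borel)"
    unfolding borel_prod
    by (rule borel_measurable_continuous_onI[OF continuous_on_space_grad[OF \<phi>]])
  have pr: "Pair s \<in> measurable (borel :: 'a measure) (borel \<Otimes>\<^sub>M borel)" for s :: real
    by (rule measurable_Pair1') simp
  have td'[measurable]: "time_deriv \<phi> s \<in> borel_measurable borel" for s
    using measurable_compose[OF pr td] by (simp only: fst_conv snd_conv)
  have sg'[measurable]: "space_grad \<phi> s \<in> borel_measurable borel" for s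
    using measurable_compose[OF pr sg] by (simp only: fst_conv snd_conv)
  \<comment> \<open>With the time indicator included, both integrands are bounded and live on a set
    of finite product measure, so they are integrable.\<close>
  define J1 where "J1 = (\<lambda>s p. indicator ?I s * time_deriv \<phi> s (T s p))"
  define J2 where "J2 = (\<lambda>s p. indicator ?I s * (space_grad \<phi> s (T s p) \<bullet> V p))"
  have sT: "(\<lambda>x. (fst x, T (fst x) (snd x))) \<in> measurable (lborel \<Otimes>\<^sub>M \<pi>) (borel \<Otimes>\<^sub>M borel)"
    by measurable
  have [measurable]: "(\<lambda>x. time_deriv \<phi> (fst x) (T (fst x) (snd x))) \<in> borel_measurable (lborel \<Otimes>\<^sub>M \<pi>)"
    using measurable_compose[OF sT td] by (simp only: fst_conv snd_conv)
  have [measurable]: "(\<lambda>x. space_grad \<phi> (fst x) (T (fst x) (snd x))) \<in> borel_measurable (lborel \<Otimes>\<^sub>M \<pi>)"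
    using measurable_compose[OF sT sg] by (simp only: fst_conv snd_conv)
  have m1: "case_prod J1 \<in> borel_measurable (lborel \<Otimes>\<^sub>M \<pi>)"
    unfolding J1_def case_prod_beta by measurable
  have m2: "case_prod J2 \<in> borel_measurable (lborel \<Otimes>\<^sub>M \<pi>)"
    unfolding J2_def case_prod_beta by measurable
  have UNIV_sets: "UNIV \<in> sets \<pi>" using sets.top[of \<pi>] by (simp add: space_\<pi>)
  have fin: "emeasure (lborel \<Otimes>\<^sub>M \<pi>) (?I \<times> UNIV) < \<infinity>"
    using emeasure_finite[of UNIV] UNIV_sets
    by (subst emeasure_pair_measure_Times) (auto simp: ennreal_mult_less_top less_top[symmetric])
  have I: "?I \<times> UNIV \<in> sets (lborel \<Otimes>\<^sub>M \<pi>)"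
    using UNIV_sets by (intro pair_measureI) auto
  have i1: "integrable (lborel \<Otimes>\<^sub>M \<pi>) (case_prod J1)"
    by (rule integrableI_bounded_set[OF I m1 fin, where B = B])
       (use B in \<open>auto simp: J1_def indicator_def intro!: AE_I2\<close>)
  have "\<bar>space_grad \<phi> s x \<bullet> V p\<bar> \<le> L * K" for s x p
    by (rule order_trans[OF Cauchy_Schwarz_ineq2]) (intro mult_mono L norm_V L0 norm_ge_zero)
  then have i2: "integrable (lborel \<Otimes>\<^sub>M \<pi>) (case_prod J2)"
    by (intro integrableI_bounded_set[OF I m2 fin, where B = "L * K"])
       (auto simp: J2_def indicator_def intro!: AE_I2)
  have e1: "(LINT s:?I|lborel. (\<integral>x. time_deriv \<phi> s x \<partial>\<mu> s)) = (LINT s|lborel. (LINT p|\<pi>. J1 s p))"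
    unfolding set_lebesgue_integral_def \<mu>_def J1_def
    by (intro Bochner_Integration.integral_cong refl) (simp add: integral_distr)
  have e2: "(LINT s:?I|lborel. vector_integral (\<nu> s) (space_grad \<phi> s)) = (LINT s|lborel. (LINT p|\<pi>. J2 s p))"
    unfolding set_lebesgue_integral_def J2_def
    by (intro Bochner_Integration.integral_cong refl) (simp add: vector_integral_\<nu>[OF sg' L])
  \<comment> \<open>Along one segment the integrand is the time derivative of
    \<open>\<phi> (s, T s p)\<close>, so its integral is a difference of boundary values, and these
    vanish.\<close>
  have zero: "(LINT s|lborel. J1 s p + J2 s p) = 0" if p: "p \<in> \<Omega> \<times> \<Omega>" for p
  proof -
    let ?v = "(1 :: real, snd p - fst p)"
    have V: "V p = snd p - fst p" using p by (simp add: V_def)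
    have add: "time_deriv \<phi> s x + space_grad \<phi> s x \<bullet> V p = ?D s x ?v" for s x
    proof -
      interpret D: linear "?D s x"
        using test_function_derivative(1)[OF \<phi>] has_derivative_linear by blast
      show ?thesis
        using D.add[of "(1, 0)" "(0, snd p - fst p)"]
        by (simp add: time_deriv_def space_grad_inner[OF \<phi>] V)
    qed
    have path: "((\<lambda>s. (s, T s p)) has_vector_derivative ?v) (at s within S)" for s S
      unfolding T_def has_vector_derivative_def
      by (auto intro!: derivative_eq_intros simp: algebra_simps)
    have der: "((\<lambda>s. \<phi> (s, T s p)) has_vector_derivative ?D s (T s p) ?v) (at s within S)" for s S
    proof -
      interpret D: linear "?D s (T s p)"
        using test_function_derivative(1)[OF \<phi>] has_derivative_linear by blast
      show ?thesis
        using has_derivative_compose[OF path[unfolded has_vector_derivative_def]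
            test_function_derivative(1)[OF \<phi>], of s S]
        unfolding has_vector_derivative_def D.scale .
    qed
    have cont: "continuous_on S (\<lambda>s. ?D s (T s p) ?v)" for S
      by (rule continuous_on_compose2[OF test_function_derivative(2)[OF \<phi>]])
         (auto simp: T_def intro!: continuous_intros)
    have bdry: "\<phi> (0, x) = 0" "\<phi> (1, x) = 0" for x
    proof -
      have "closure {z. \<phi> z \<noteq> 0} \<subseteq> {0<..<1} \<times> (UNIV :: 'a set)" using \<phi> by (simp add: test_function_def)
      with closure_subset have "{z. \<phi> z \<noteq> 0} \<subseteq> {0<..<1} \<times> UNIV" by (rule order_trans)
      then show "\<phi> (0, x) = 0" "\<phi> (1, x) = 0" by auto
    qed
    have "(LINT s|lborel. J1 s p + J2 s p) = (LINT s|lborel. indicator ?I s *\<^sub>R ?D s (T s p) ?v)"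
      by (simp add: J1_def J2_def flip: distrib_left add)
    \<comment> \<open>The two endpoints are negligible, and the fundamental theorem of calculus is
      applied on the closed interval.\<close>
    also have "\<dots> = (LINT s|lborel. indicator {0..1} s *\<^sub>R ?D s (T s p) ?v)"
    proof (rule integral_cong_AE)
      show "AE s in lborel. indicator ?I s *\<^sub>R ?D s (T s p) ?v = indicator {0..1} s *\<^sub>R ?D s (T s p) ?v"
        using AE_lborel_singleton[of 0] AE_lborel_singleton[of 1]
        by eventually_elim (auto simp: indicator_def)
      have [measurable]: "(\<lambda>s. ?D s (T s p) ?v) \<in> borel_measurable borel"
        by (rule borel_measurable_continuous_onI[OF cont])
      show "(\<lambda>s. indicator ?I s *\<^sub>R ?D s (T s p) ?v) \<in> borel_measurable lborel"
        "(\<lambda>s. indicator {0..1} s *\<^sub>R ?D s (T s p) ?v) \<in> borel_measurable lborel"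
        by measurable
    qed
    also have "\<dots> = \<phi> (1, T 1 p) - \<phi> (0, T 0 p)"
      by (rule integral_FTC_atLeastAtMost[where F = "\<lambda>s. \<phi> (s, T s p)"]) (use der cont in auto)
    finally show ?thesis using bdry by simp
  qed
  have i12: "integrable (lborel \<Otimes>\<^sub>M \<pi>) (\<lambda>(s, p). J1 s p + J2 s p)"
    using Bochner_Integration.integrable_add[OF i1 i2] by (simp add: case_prod_unfold)
  have "(LINT s|lborel. (LINT p|\<pi>. J1 s p)) + (LINT s|lborel. (LINT p|\<pi>. J2 s p))
      = integral\<^sup>L (lborel \<Otimes>\<^sub>M \<pi>) (case_prod J1) + integral\<^sup>L (lborel \<Otimes>\<^sub>M \<pi>) (case_prod J2)"
    using LP.integral_fst'[OF i1] LP.integral_fst'[OF i2] by simp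
  also have "\<dots> = integral\<^sup>L (lborel \<Otimes>\<^sub>M \<pi>) (\<lambda>x. case_prod J1 x + case_prod J2 x)"
    by (rule Bochner_Integration.integral_add[symmetric, OF i1 i2])
  also have "\<dots> = integral\<^sup>L (lborel \<Otimes>\<^sub>M \<pi>) (\<lambda>(s, p). J1 s p + J2 s p)"
    by (simp add: case_prod_unfold)
  also have "\<dots> = (LINT p|\<pi>. (LINT s|lborel. J1 s p + J2 s p))"
    by (rule LP.integral_snd[OF i12, symmetric])
  also have "\<dots> = (LINT p|\<pi>. 0)"
  proof (rule integral_cong_AE)
    show "(\<lambda>p. LINT s|lborel. J1 s p + J2 s p) \<in> borel_measurable \<pi>"
      using LP.integrable_snd[OF i12] by (rule borel_measurable_integrable)
    \<comment> \<open>Off \<open>\<Omega> \<times> \<Omega>\<close> the cut-off \<open>V\<close>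
      need not be the velocity of the segment, so the identity is claimed only almost
      everywhere.\<close>
    show "AE p in \<pi>. (LINT s|lborel. J1 s p + J2 s p) = 0"
      using AE_\<pi> by eventually_elim (rule zero)
  qed simp
  finally show ?thesis unfolding e1 e2 by simp
qed

lemma CE_interpolation: "(\<mu>, \<nu>) \<in> CE \<Omega> (distr \<pi> borel fst) (distr \<pi> borel snd)"
proof -
  have "T 0 = fst" "T 1 = snd" by (auto simp: T_def)
  then have ends: "\<mu> 0 = distr \<pi> borel fst" "\<mu> 1 = distr \<pi> borel snd" by (auto simp: \<mu>_def)
  have "(\<integral>\<^sup>+s\<in>{0<..<1}. total_variation (\<nu> s) (closure \<Omega>) \<partial>lborel)
      \<le> (\<integral>\<^sup>+s. (ennreal K * emeasure \<pi> UNIV) * indicator {0<..<1::real} s \<partial>lborel)"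
  proof (intro nn_integral_mono mult_right_mono)
    fix s
    have "total_variation (\<nu> s) (closure \<Omega>) \<le> ennreal K * emeasure (\<mu> s) (closure \<Omega>)"
      by (rule total_variation_\<nu>)
    also have "\<dots> \<le> ennreal K * emeasure \<pi> UNIV"
      unfolding emeasure_\<mu>_UNIV[of s, symmetric] by (intro mult_left_mono emeasure_mono) auto
    finally show "total_variation (\<nu> s) (closure \<Omega>) \<le> ennreal K * emeasure \<pi> UNIV" .
  qed simp
  also have "\<dots> < \<infinity>"
    using emeasure_finite[of UNIV]
    by (subst nn_integral_cmult_indicator) (auto simp: ennreal_mult_eq_top_iff less_top[symmetric])
  finally have tv: "(\<integral>\<^sup>+s\<in>{0<..<1}. total_variation (\<nu> s) (closure \<Omega>) \<partial>lborel) < \<infinity>" .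
  have "\<forall>s\<in>{0..1}. \<mu> s \<in> pos_measures (closure \<Omega>)"
    using \<mu>_pos_measures by blast
  moreover have "\<forall>s\<in>{0<..<1}. \<nu> s \<in> vector_measures (closure \<Omega>)"
    by (intro ballI \<nu>_vector_measures) auto
  moreover have "\<forall>B\<in>sets borel. (\<lambda>s. \<nu> s B) \<in> borel_measurable (restrict_space borel {0<..<1})"
    by (intro ballI measurable_restrict_space1 \<nu>_measurable)
  ultimately show ?thesis
    unfolding CE_def mem_Collect_eq prod.case
    using \<mu>_weak_star_continuous ends tv continuity_equation by (intro conjI allI impI)
qed

text \<open>With the velocity field \<open>g\<close>, the measure \<open>\<nu> s\<close> has
  Lebesgue density \<open>\<rho> x *\<^sub>R g x\<close>, whose norm is at most the bound on
  \<open>g\<close> times \<open>\<rho> x\<close>.\<close>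

lemma action_interpolation_le:
  assumes m: "mobility m" and s: "s \<in> {0..1}"
    and \<rho>: "\<rho> \<in> borel_measurable borel" "\<And>x. 0 \<le> \<rho> x"
    and \<mu>\<rho>: "\<mu> s = density lborel (\<lambda>x. ennreal (\<rho> x))"
  shows "action m \<Omega> (\<mu> s) (\<nu> s)
    \<le> ennreal ((DIM('a) * K)\<^sup>2) * (\<integral>\<^sup>+x. ennreal ((\<rho> x)\<^sup>2 / m (\<rho> x)) \<partial>lborel)"
proof -
  note [measurable] = \<rho>(1)
  let ?C = "DIM('a) * K"
  have C0: "0 \<le> ?C" using K_nonneg by simp
  obtain g where g[measurable]: "g \<in> borel_measurable borel" and gK: "\<And>z. norm (g z) \<le> ?C"
    and \<nu>g: "\<And>B. B \<in> sets borel \<Longrightarrow> \<nu> s B = (LINT z:B|\<mu> s. g z)"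
    by (rule velocity_field[of s]) blast
  have "(\<integral>\<^sup>+x. ennreal (\<rho> x) \<partial>lborel) = emeasure (\<mu> s) UNIV"
    unfolding \<mu>\<rho> by (simp add: emeasure_density)
  also have "\<dots> < \<infinity>"
    using finite_measure.emeasure_finite[OF finite_\<mu>, of s UNIV] by (simp add: less_top)
  finally have \<rho>i: "integrable lborel \<rho>"
    using \<rho>(2) by (simp add: integrable_iff_bounded)
  have wle: "norm (\<rho> x *\<^sub>R g x) \<le> ?C * \<rho> x" for x
    using mult_right_mono[OF gK[of x] \<rho>(2)[of x]] \<rho>(2)[of x] by (simp add: mult.commute)
  have wi: "integrable lborel (\<lambda>x. \<rho> x *\<^sub>R g x)"
  proof (rule Bochner_Integration.integrable_bound)
    show "integrable lborel (\<lambda>x. ?C * \<rho> x)" using \<rho>i by (rule integrable_mult_right)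
    show "AE x in lborel. norm (\<rho> x *\<^sub>R g x) \<le> norm (?C * \<rho> x)"
      using wle C0 \<rho>(2) by (auto intro!: AE_I2 simp: abs_of_nonneg)
  qed measurable
  have \<nu>w: "\<nu> s A = (LINT x:A|lborel. \<rho> x *\<^sub>R g x)" if [measurable]: "A \<in> sets borel" for A
    unfolding \<nu>g[OF that] \<mu>\<rho> set_lebesgue_integral_def
    using \<rho>(2) by (subst integral_density) (auto simp: mult.commute)
  have "total_variation (\<nu> s) (- closure \<Omega>) = 0"
    using \<nu>_vector_measures[OF s] by (simp add: vector_measures_def)
  then show ?thesis
    using wle by (intro action_le_nn_integral[OF m \<mu>\<rho> \<mu>_outside[OF s] \<rho>i \<rho>(2) _ wi \<nu>w]) auto
qed

end

section \<open>Finiteness of the distance\<close>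

text \<open>This lets the normalising factor of the coupling sit on either marginal, so that
  whichever marginal keeps its density, the other is a probability measure for Jensen.\<close>

lemma pair_measure_scale_swap:
  assumes "finite_measure M" "finite_measure N"
    and "finite_measure (scale_measure k M)" "finite_measure (scale_measure k N)"
  shows "M \<Otimes>\<^sub>M scale_measure k N = scale_measure k M \<Otimes>\<^sub>M N"
proof (rule pair_measure_eqI)
  show "sigma_finite_measure M" "sigma_finite_measure (scale_measure k N)"
    using assms by (auto simp: finite_measure_def)
  have "sigma_finite_measure N" using assms by (simp add: finite_measure_def)
  then show "emeasure M A * emeasure (scale_measure k N) B = emeasure (scale_measure k M \<Otimes>\<^sub>M N) (A \<times> B)"
    if "A \<in> sets M" "B \<in> sets (scale_measure k N)" for A B
    using that by (simp add: sigma_finite_measure.emeasure_pair_measure_Times mult_ac)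
  show "sets (M \<Otimes>\<^sub>M scale_measure k N) = sets (scale_measure k M \<Otimes>\<^sub>M N)"
    by (intro sets_pair_measure_cong) auto
qed

text \<open>Wherever the modified density is positive, so is the mobility, and real and extended
  division agree; elsewhere the left integrand is 0.\<close>

lemma nn_integral_square_div_mobility_indicator:
  assumes m: "mobility m"
  shows "(\<integral>\<^sup>+x. ennreal ((max 0 (indicator \<Omega> x * \<rho> x))\<^sup>2 / m (max 0 (indicator \<Omega> x * \<rho> x))) \<partial>lborel)
    \<le> (\<integral>\<^sup>+x\<in>\<Omega>. ennreal ((\<rho> x)\<^sup>2) / ennreal (m (\<rho> x)) \<partial>lborel)"
proof (rule nn_integral_mono)
  fix x
  show "ennreal ((max 0 (indicator \<Omega> x * \<rho> x))\<^sup>2 / m (max 0 (indicator \<Omega> x * \<rho> x)))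
      \<le> ennreal ((\<rho> x)\<^sup>2) / ennreal (m (\<rho> x)) * indicator \<Omega> x"
  proof (cases "x \<in> \<Omega> \<and> 0 < \<rho> x")
    case True
    then show ?thesis
      using mobility_pos[OF m, of "\<rho> x"] by (simp add: divide_ennreal max_absorb2)
  next
    case False
    then have "max 0 (indicator \<Omega> x * \<rho> x) = 0" by (auto simp: indicator_def max_def)
    then show ?thesis by simp
  qed
qed

theorem theorem3p7:
  fixes \<Omega> :: "'a::euclidean_space set"
    and m :: "real \<Rightarrow> real"
    and c :: real
    and \<rho>0 \<rho>1 :: "'a \<Rightarrow> real"
    and \<mu>0 \<mu>1 :: "'a measure"
  assumes "bounded \<Omega>" "open \<Omega>" "convex \<Omega>"
    and "mobility m"
    and "0 < c"
    and "set_borel_measurable lborel \<Omega> \<rho>0" "AE x in lborel. x \<in> \<Omega> \<longrightarrow> 0 \<le> \<rho>0 x"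
    and "set_borel_measurable lborel \<Omega> \<rho>1" "AE x in lborel. x \<in> \<Omega> \<longrightarrow> 0 \<le> \<rho>1 x"
    and "\<mu>0 = density lborel (\<lambda>x. ennreal (\<rho>0 x) * indicator \<Omega> x)"
    and "\<mu>1 = density lborel (\<lambda>x. ennreal (\<rho>1 x) * indicator \<Omega> x)"
    and "\<mu>0 \<in> pos_measures_mass \<Omega> c"
    and "\<mu>1 \<in> pos_measures_mass \<Omega> c"
    and "(\<integral>\<^sup>+x\<in>\<Omega>. ennreal ((\<rho>0 x)\<^sup>2) / ennreal (m (\<rho>0 x)) \<partial>lborel) < \<infinity>"
    and "(\<integral>\<^sup>+x\<in>\<Omega>. ennreal ((\<rho>1 x)\<^sup>2) / ennreal (m (\<rho>1 x)) \<partial>lborel) < \<infinity>"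
  shows "mob_dist m \<Omega> \<mu>0 \<mu>1 < \<infinity>"
proof -
  note m = assms(4)
  \<comment> \<open>Representatives that are measurable on the whole space, nonnegative everywhere
    and 0 off \<open>\<Omega>\<close>; the given densities have these properties only on
    \<open>\<Omega>\<close> or almost everywhere.\<close>
  define r0 where "r0 = (\<lambda>x. max 0 (indicator \<Omega> x * \<rho>0 x))"
  define r1 where "r1 = (\<lambda>x. max 0 (indicator \<Omega> x * \<rho>1 x))"
  have [measurable]: "(\<lambda>x. indicator \<Omega> x * \<rho>0 x) \<in> borel_measurable borel"
    "(\<lambda>x. indicator \<Omega> x * \<rho>1 x) \<in> borel_measurable borel"
    using assms(6,8) by (simp_all add: set_borel_measurable_def)
  have r: "r0 \<in> borel_measurable borel" "r1 \<in> borel_measurable borel"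
    "\<And>x. 0 \<le> r0 x" "\<And>x. 0 \<le> r1 x"
    unfolding r0_def r1_def by auto
  have "ennreal (\<rho> x) * indicator \<Omega> x = ennreal (max 0 (indicator \<Omega> x * \<rho> x))" for \<rho> and x :: 'a
    by (auto simp: indicator_def max_def ennreal_neg)
  then have \<mu>: "\<mu>0 = density lborel (\<lambda>x. ennreal (r0 x))" "\<mu>1 = density lborel (\<lambda>x. ennreal (r1 x))"
    unfolding assms(10,11) r0_def r1_def by simp_all
  define A0 where "A0 = (\<integral>\<^sup>+x. ennreal ((r0 x)\<^sup>2 / m (r0 x)) \<partial>lborel)"
  define A1 where "A1 = (\<integral>\<^sup>+x. ennreal ((r1 x)\<^sup>2 / m (r1 x)) \<partial>lborel)"
  have A: "A0 < \<infinity>" "A1 < \<infinity>"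
    unfolding A0_def A1_def r0_def r1_def
    using nn_integral_square_div_mobility_indicator[OF m] assms(14,15) order.strict_trans1 by blast+
  have f: "finite_measure \<mu>0" "finite_measure \<mu>1"
    and mass: "emeasure \<mu>0 UNIV = ennreal c" "emeasure \<mu>1 UNIV = ennreal c"
    and out: "emeasure \<mu>0 (- \<Omega>) = 0" "emeasure \<mu>1 (- \<Omega>) = 0"
    using assms(12,13) by (auto simp: pos_measures_mass_def pos_measures_def)
  have s[measurable_cong]: "sets \<mu>0 = sets borel" "sets \<mu>1 = sets borel"
    using \<mu> by auto
  have sp: "space \<mu>0 = UNIV" "space \<mu>1 = UNIV"
    using \<mu> by auto
  define k where "k = ennreal (1 / c)"
  have kc: "k * ennreal c = 1"
    using assms(5) by (simp add: k_def flip: ennreal_mult)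
  let ?P0 = "scale_measure k \<mu>0" and ?P1 = "scale_measure k \<mu>1"
  have P: "prob_space ?P0" "prob_space ?P1"
    using kc mass by (auto intro!: prob_spaceI simp: space_scale_measure sp)
  have fP: "finite_measure ?P0" "finite_measure ?P1"
    using P by (auto simp: prob_space_def)
  \<comment> \<open>Only one factor is normalised, so the coupling has mass \<open>c\<close> and its
    marginals are exactly \<open>\<mu>0\<close> and \<open>\<mu>1\<close>.\<close>
  define \<pi> where "\<pi> = \<mu>0 \<Otimes>\<^sub>M ?P1"
  have \<pi>': "\<pi> = ?P0 \<Otimes>\<^sub>M \<mu>1"
    unfolding \<pi>_def by (rule pair_measure_scale_swap[OF f fP])
  interpret \<mu>0: finite_measure \<mu>0 by (rule f)
  interpret \<mu>1: finite_measure \<mu>1 by (rule f)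
  interpret P0: prob_space ?P0 by (rule P)
  interpret P1: prob_space ?P1 by (rule P)
  interpret pair_sigma_finite \<mu>0 ?P1 ..
  interpret Q: pair_sigma_finite ?P0 \<mu>1 ..
  have [measurable]: "\<Omega> \<in> sets borel" using assms(2) by simp
  have \<pi>_sets: "sets \<pi> = sets (borel \<Otimes>\<^sub>M borel)"
    unfolding \<pi>_def by (intro sets_pair_measure_cong) (auto simp: s)
  have ae: "AE x in \<mu>0. x \<in> \<Omega>" "AE x in ?P1. x \<in> \<Omega>"
    using out by (auto intro!: AE_I[where N = "- \<Omega>"] simp: s)
  have "AE p in \<pi>. p \<in> \<Omega> \<times> \<Omega>"
    unfolding \<pi>_def
  proof (rule AE_pair_measure)
    show "AE x in \<mu>0. AE y in ?P1. (x, y) \<in> \<Omega> \<times> \<Omega>"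
      using ae(1) by eventually_elim (use ae(2) in auto)
  qed measurable
  then interpret I: displacement_interpolation \<pi> \<Omega>
    unfolding displacement_interpolation_def displacement_interpolation_axioms_def
    using \<pi>_sets assms(1,3) finite_measure_pair_measure[OF fP(2) f(1)] by (simp add: \<pi>_def)
  have "distr \<pi> borel fst = \<mu>0"
  proof (rule measure_eqI)
    fix B assume "B \<in> sets (distr \<pi> borel fst)"
    then have B: "B \<in> sets borel" by simp
    have "fst -` B \<inter> space \<pi> = B \<times> UNIV"
      by (auto simp: \<pi>_def space_pair_measure sp space_scale_measure)
    then have "emeasure (distr \<pi> borel fst) B = emeasure \<pi> (B \<times> UNIV)"
      using B \<pi>_sets by (subst emeasure_distr) auto
    also have "\<dots> = emeasure \<mu>0 B"
      unfolding \<pi>_def using B by (subst P1.emeasure_pair_measure_Times) (auto simp: s mass kc)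
    finally show "emeasure (distr \<pi> borel fst) B = emeasure \<mu>0 B" .
  qed (simp add: s)
  moreover have "distr \<pi> borel snd = \<mu>1"
  proof (rule measure_eqI)
    fix B assume "B \<in> sets (distr \<pi> borel snd)"
    then have B: "B \<in> sets borel" by simp
    have "snd -` B \<inter> space \<pi> = UNIV \<times> B"
      by (auto simp: \<pi>_def space_pair_measure sp space_scale_measure)
    then have "emeasure (distr \<pi> borel snd) B = emeasure \<pi> (UNIV \<times> B)"
      using B \<pi>_sets by (subst emeasure_distr) auto
    also have "\<dots> = emeasure \<mu>1 B"
      unfolding \<pi>' using B by (subst \<mu>1.emeasure_pair_measure_Times) (auto simp: s mass kc)
    finally show "emeasure (distr \<pi> borel snd) B = emeasure \<mu>1 B" .
  qed (simp add: s)
  ultimately have CE: "(I.\<mu>, I.\<nu>) \<in> CE \<Omega> \<mu>0 \<mu>1"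
    using I.CE_interpolation by simp
  define C where "C = ennreal ((DIM('a) * I.K)\<^sup>2)"
  \<comment> \<open>A bound independent of time: \<open>C\<close> comes from the velocity, and
    \<open>A0 + A1\<close> covers both halves of the time interval.\<close>
  define E where "E = C * (ennreal (2 ^ DIM('a)) * (A0 + A1))"
  have act: "action m \<Omega> (I.\<mu> t) (I.\<nu> t) \<le> E" if t: "0 < t" "t < 1" for t
  proof -
    have "\<exists>\<rho>. \<rho> \<in> borel_measurable borel \<and> (\<forall>x. 0 \<le> \<rho> x) \<and>
        I.\<mu> t = density lborel (\<lambda>x. ennreal (\<rho> x)) \<and>
        (\<integral>\<^sup>+x. ennreal ((\<rho> x)\<^sup>2 / m (\<rho> x)) \<partial>lborel) \<le> ennreal (2 ^ DIM('a)) * (A0 + A1)"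
    \<comment> \<open>The marginal with the larger weight keeps its density: its dilation factor is
      at least \<open>1/2\<close>.\<close>
    proof (cases "t \<le> 1/2")
      case True
      have T: "I.\<mu> t = distr (\<mu>0 \<Otimes>\<^sub>M ?P1) borel (\<lambda>(x, y). (1 - t) *\<^sub>R x + t *\<^sub>R y)"
        unfolding I.\<mu>_def I.T_def[abs_def] by (simp add: \<pi>_def case_prod_beta')
      obtain \<rho> where \<rho>: "\<rho> \<in> borel_measurable borel" "\<And>z. 0 \<le> \<rho> z"
          "I.\<mu> t = density lborel (\<lambda>z. ennreal (\<rho> z))"
          "(\<integral>\<^sup>+z. ennreal ((\<rho> z)\<^sup>2 / m (\<rho> z)) \<partial>lborel) \<le> ennreal (2 ^ DIM('a)) * A0"
        by (rule distr_affine_sum_density[OF m r(1,3) f(1)[unfolded \<mu>] P(2), of "1 - t" t])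
           (use True t T \<mu> s in \<open>auto simp: A0_def\<close>)
      have "ennreal (2 ^ DIM('a)) * A0 \<le> ennreal (2 ^ DIM('a)) * (A0 + A1)"
        by (intro mult_left_mono) auto
      with \<rho> show ?thesis using order_trans by blast
    next
      case False
      \<comment> \<open>The factors are swapped so that \<open>\<mu>1\<close>, now carrying the
        weight \<open>t\<close>, comes first as in the density lemma.\<close>
      have "I.\<mu> t = distr (distr (\<mu>1 \<Otimes>\<^sub>M ?P0) (?P0 \<Otimes>\<^sub>M \<mu>1) (\<lambda>(x, y). (y, x))) borel
          (\<lambda>p. (1 - t) *\<^sub>R fst p + t *\<^sub>R snd p)"
        unfolding I.\<mu>_def I.T_def[abs_def] unfolding \<pi>' by (subst Q.distr_pair_swap) simp
      also have "\<dots> = distr (\<mu>1 \<Otimes>\<^sub>M ?P0) borel (\<lambda>(x, y). t *\<^sub>R x + (1 - t) *\<^sub>R y)"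
        by (subst distr_distr) (auto simp: comp_def case_prod_beta' add.commute)
      finally have T: "I.\<mu> t = distr (\<mu>1 \<Otimes>\<^sub>M ?P0) borel (\<lambda>(x, y). t *\<^sub>R x + (1 - t) *\<^sub>R y)" .
      obtain \<rho> where \<rho>: "\<rho> \<in> borel_measurable borel" "\<And>z. 0 \<le> \<rho> z"
          "I.\<mu> t = density lborel (\<lambda>z. ennreal (\<rho> z))"
          "(\<integral>\<^sup>+z. ennreal ((\<rho> z)\<^sup>2 / m (\<rho> z)) \<partial>lborel) \<le> ennreal (2 ^ DIM('a)) * A1"
        by (rule distr_affine_sum_density[OF m r(2,4) f(2)[unfolded \<mu>] P(1), of t "1 - t"])
           (use False t T \<mu> s in \<open>auto simp: A1_def\<close>)
      have "ennreal (2 ^ DIM('a)) * A1 \<le> ennreal (2 ^ DIM('a)) * (A0 + A1)"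
        by (intro mult_left_mono) auto
      with \<rho> show ?thesis using order_trans by blast
    qed
    then obtain \<rho> where \<rho>: "\<rho> \<in> borel_measurable borel" "\<And>x. 0 \<le> \<rho> x"
        "I.\<mu> t = density lborel (\<lambda>x. ennreal (\<rho> x))"
      and le: "(\<integral>\<^sup>+x. ennreal ((\<rho> x)\<^sup>2 / m (\<rho> x)) \<partial>lborel) \<le> ennreal (2 ^ DIM('a)) * (A0 + A1)"
      by blast
    have "action m \<Omega> (I.\<mu> t) (I.\<nu> t) \<le> C * (\<integral>\<^sup>+x. ennreal ((\<rho> x)\<^sup>2 / m (\<rho> x)) \<partial>lborel)"
      unfolding C_def using t by (intro I.action_interpolation_le[OF m _ \<rho>]) auto
    also have "\<dots> \<le> E" unfolding E_def by (rule mult_left_mono[OF le]) simp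
    finally show ?thesis .
  qed
  have "mob_dist_sq m \<Omega> \<mu>0 \<mu>1 \<le> (\<integral>\<^sup>+t\<in>{0<..<1}. action m \<Omega> (I.\<mu> t) (I.\<nu> t) \<partial>lborel)"
    unfolding mob_dist_sq_def by (rule INF_lower2[OF CE]) simp
  also have "\<dots> \<le> (\<integral>\<^sup>+t. E * indicator {0<..<1::real} t \<partial>lborel)"
    by (intro nn_integral_mono) (auto simp: indicator_def act)
  also have "\<dots> = E" by (subst nn_integral_cmult_indicator) auto
  also have "\<dots> < \<infinity>"
    using A by (auto simp: E_def C_def ennreal_mult_less_top)
  finally show ?thesis by (simp add: mob_dist_def)
qed

end
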